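(* Let $\mathcal X$ be a smooth projective geometrically irreducible curve over $\mathbb F_q$, let $D=P_1+\cdots+P_N$ be a sum of distinct $\mathbb F_q$-rational points of $\mathcal X$, and let $G$ and $A$ be divisors on $\mathcal X$ over $\mathbb F_q$ with $\operatorname{Supp} G\cap\operatorname{Supp} D=\operatorname{Supp} A\cap\operatorname{Supp} D=\emptyset$. With $R(G,A)$, $R_0(G,A)$ and $\varepsilon(G,A)$ as defined in the context, the following hold. (1) $R_0(G,A)\subseteq R(G,A)$; in particular $\varepsilon(G,A)\ge 0$. (2) $C_L(D,G\wedge A)\subseteq C_L(D,G)\cap C_L(D,A)$. (3) There is a canonical isomorphism of $\mathbb F_q$-vector spaces $$\bigl(C_L(D,G)\cap C_L(D,A)\bigr)\big/ C_L(D,G\wedge A)\;\cong\; R(G,A)/R_0(G,A).$$ (4) Consequently, $$\dim\bigl(C_L(D,G)\cap C_L(D,A)\bigr)=\ell(G\wedge A)-\ell(G\wedge A-D)+\varepsilon(G,A).$$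
   Context: For a divisor $G$ on $\mathcal X$, $L(G)=\{h\in\mathbb F_q(\mathcal X)^*:\operatorname{div}(h)+G\ge 0\}\cup\{0\}$ and $\ell(G)=\dim_{\mathbb F_q}L(G)$. If $\operatorname{Supp} G\cap \operatorname{Supp} D=\emptyset$, then $C_L(D,G)\subseteq\mathbb F_q^N$ is the image of the evaluation map $\operatorname{ev}:L(G)\to\mathbb F_q^N$, $h\mapsto(h(P_1),\dots,h(P_N))$. For divisors $G_1,G_2$, the meet $G_1\wedge G_2$ and the join $G_1\vee G_2$ are the divisors whose coefficient at each place is respectively the minimum and the maximum of the coefficients of $G_1$ and $G_2$. Define the subspaces of $\mathbb F_q(\mathcal X)$ $$R(G,A)=\bigl(L(G)+L(A)\bigr)\cap L(G\vee A-D),\qquad R_0(G,A)=L(G-D)+L(A-D),$$ and the excess $\varepsilon(G,A)=\dim_{\mathbb F_q}R(G,A)/R_0(G,A)$. *)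

theory Defs
  imports
    "HOL-Analysis.Cartesian_Space"
    "HOL-Computational_Algebra.Polynomial"
    "HOL-Library.Poly_Mapping"
    "HOL-Library.Set_Algebras"
    "Jordan_Normal_Form.Missing_VectorSpace"
begin

section \<open>Projective curves\<close>

text \<open>
  An integral projective scheme over a field \<open>k\<close> is given by its function field \<open>K\<close> (the type
  \<open>'f\<close>), the embedding of \<open>k\<close> (the type \<open>'k\<close>) into \<open>K\<close>, and the homogeneous coordinates
  \<open>[x\<^sub>0, \<dots>, x\<^sub>n]\<close> of its generic point in \<open>\<bbbP>\<^sup>n(K)\<close>: the scheme is the Zariski closure of that
  point in \<open>\<bbbP>\<^sup>n\<close> over \<open>k\<close>.  Its standard affine charts are the spectra of the rings
  \<open>k[x\<^sub>0/x\<^sub>i, \<dots>, x\<^sub>n/x\<^sub>i]\<close> with \<open>x\<^sub>i \<noteq> 0\<close> (the chart is empty if \<open>x\<^sub>i = 0\<close>), and, the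
  scheme being integral and separated, its points are identified with their local rings inside
  \<open>K\<close> (a projective model in the sense of Zariski and Samuel).
\<close>

record ('k, 'f) curve =
  emb :: "'k \<Rightarrow> 'f"
  coords :: "'f list"

inductive_set generated_algebra :: "('k \<Rightarrow> 'f::field) \<Rightarrow> 'f set \<Rightarrow> 'f set"
  for e :: "'k \<Rightarrow> 'f" and S :: "'f set" where
  const: "e c \<in> generated_algebra e S"
| gen: "s \<in> S \<Longrightarrow> s \<in> generated_algebra e S"
| add: "a \<in> generated_algebra e S \<Longrightarrow> b \<in> generated_algebra e S \<Longrightarrow> a + b \<in> generated_algebra e S"
| mult: "a \<in> generated_algebra e S \<Longrightarrow> b \<in> generated_algebra e S \<Longrightarrow> a * b \<in> generated_algebra e S"

definition prime_ideal_in :: "'f::field set \<Rightarrow> 'f set \<Rightarrow> bool" where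
  "prime_ideal_in A p \<longleftrightarrow>
     p \<subseteq> A \<and> 0 \<in> p \<and> 1 \<notin> p \<and>
     (\<forall>a\<in>p. \<forall>b\<in>p. a + b \<in> p) \<and> (\<forall>a\<in>A. \<forall>b\<in>p. a * b \<in> p) \<and>
     (\<forall>a\<in>A. \<forall>b\<in>A. a * b \<in> p \<longrightarrow> a \<in> p \<or> b \<in> p)"

text \<open>The localization \<open>A\<^sub>p\<close> inside the field; \<open>localize A {0}\<close> is the fraction field of \<open>A\<close>.\<close>

definition localize :: "'f::field set \<Rightarrow> 'f set \<Rightarrow> 'f set" where
  "localize A p = {a / s | a s. a \<in> A \<and> s \<in> A - p}"

definition charts :: "('k, 'f::field) curve \<Rightarrow> 'f set set" where
  "charts X = {generated_algebra (emb X) {y / x | y. y \<in> set (coords X)} | x.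
                 x \<in> set (coords X) \<and> x \<noteq> 0}"

definition points :: "('k, 'f::field) curve \<Rightarrow> 'f set set" where
  "points X = {localize A p | A p. A \<in> charts X \<and> prime_ideal_in A p}"

text \<open>On a curve the only non-closed point is the generic one, whose local ring is \<open>K\<close>.
  The closed points are the places of \<open>X\<close>.\<close>

definition closed_points :: "('k, 'f::field) curve \<Rightarrow> 'f set set" where
  "closed_points X = points X - {UNIV}"

definition projective_integral :: "('k::field, 'f::field) curve \<Rightarrow> bool" where
  "projective_integral X \<longleftrightarrow>
     emb X 1 = 1 \<and> (\<forall>a b. emb X (a + b) = emb X a + emb X b) \<and>
     (\<forall>a b. emb X (a * b) = emb X a * emb X b) \<and>
     charts X \<noteq> {} \<and> (\<forall>A\<in>charts X. localize A {0} = UNIV)"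

definition algebraic_over :: "'f::field set \<Rightarrow> 'f \<Rightarrow> bool" where
  "algebraic_over F h \<longleftrightarrow> (\<exists>p. p \<noteq> 0 \<and> (\<forall>i. coeff p i \<in> F) \<and> poly p h = 0)"

text \<open>Dimension one: the function field has transcendence degree one over \<open>k\<close>.\<close>

definition one_dimensional :: "('k, 'f::field) curve \<Rightarrow> bool" where
  "one_dimensional X \<longleftrightarrow>
     (\<exists>y. \<not> algebraic_over (range (emb X)) y \<and>
          (\<forall>h. algebraic_over (localize (generated_algebra (emb X) {y}) {0}) h))"

definition units_of_ring :: "'f::field set \<Rightarrow> 'f set" where
  "units_of_ring P = {u \<in> P. \<exists>v\<in>P. u * v = 1}"

text \<open>For a local ring \<open>P\<close> this is its maximal ideal.\<close>

definition max_ideal :: "'f::field set \<Rightarrow> 'f set" where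
  "max_ideal P = P - units_of_ring P"

definition uniformizer :: "'f::field set \<Rightarrow> 'f \<Rightarrow> bool" where
  "uniformizer P t \<longleftrightarrow> max_ideal P = {t * a | a. a \<in> P}"

text \<open>
  The local ring at a closed point of a curve is Noetherian of dimension one, so it is regular
  iff its maximal ideal is generated by one element.  Over a perfect field, in particular over
  a finite one, smooth means that all local rings are regular.
\<close>

definition smooth :: "('k, 'f::field) curve \<Rightarrow> bool" where
  "smooth X \<longleftrightarrow> (\<forall>P\<in>closed_points X. \<exists>t. uniformizer P t)"

definition smooth_projective_curve :: "('k::field, 'f::field) curve \<Rightarrow> bool" where
  "smooth_projective_curve X \<longleftrightarrow> projective_integral X \<and> one_dimensional X \<and> smooth X"

text \<open>
  A finite extension of a finite field \<open>k\<close> has the form \<open>k' = k[T]/(p)\<close> with \<open>p\<close> irreducible and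
  separable.  The base change of \<open>X\<close> to \<open>k'\<close> has generic fibre \<open>K \<otimes> k' = K[T]/(p)\<close>, so it is
  irreducible iff \<open>p\<close> stays irreducible over \<open>K\<close>.
\<close>

definition geometrically_irreducible :: "('k::{field,finite}, 'f::field) curve \<Rightarrow> bool" where
  "geometrically_irreducible X \<longleftrightarrow>
     (\<forall>p :: 'k poly. irreducible p \<longrightarrow> irreducible (map_poly (emb X) p))"

section \<open>Divisors and Riemann-Roch spaces\<close>

text \<open>Order of vanishing of a nonzero \<open>h\<close> at a closed point.\<close>

definition ord_at :: "'f::field set \<Rightarrow> 'f \<Rightarrow> int" where
  "ord_at P h =
     (THE n. \<exists>t u. uniformizer P t \<and> u \<in> units_of_ring P \<and> h = u * t powi n)"

text \<open>Divisors are finitely supported integer functions on the closed points.  Beware that the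
  library's order on \<open>\<Rightarrow>\<^sub>0\<close> is lexicographic; the coefficientwise order is spelled out below.\<close>

type_synonym 'f divisor = "'f set \<Rightarrow>\<^sub>0 int"

definition is_divisor :: "('k, 'f::field) curve \<Rightarrow> 'f divisor \<Rightarrow> bool" where
  "is_divisor X G \<longleftrightarrow> Poly_Mapping.keys G \<subseteq> closed_points X"

lift_definition div_meet :: "'f divisor \<Rightarrow> 'f divisor \<Rightarrow> 'f divisor"
  is "\<lambda>G A P. min (G P) (A P)"
proof -
  fix G A :: "'f set \<Rightarrow> int"
  assume "finite {P. G P \<noteq> 0}" "finite {P. A P \<noteq> 0}"
  then show "finite {P. min (G P) (A P) \<noteq> 0}"
    by (rule finite_subset[rotated, OF finite_UnI]) auto
qed

lift_definition div_join :: "'f divisor \<Rightarrow> 'f divisor \<Rightarrow> 'f divisor"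
  is "\<lambda>G A P. max (G P) (A P)"
proof -
  fix G A :: "'f set \<Rightarrow> int"
  assume "finite {P. G P \<noteq> 0}" "finite {P. A P \<noteq> 0}"
  then show "finite {P. max (G P) (A P) \<noteq> 0}"
    by (rule finite_subset[rotated, OF finite_UnI]) auto
qed

definition RR_space :: "('k, 'f::field) curve \<Rightarrow> 'f divisor \<Rightarrow> 'f set" where
  "RR_space X G =
     {h. h \<noteq> 0 \<and> (\<forall>P\<in>closed_points X. ord_at P h + Poly_Mapping.lookup G P \<ge> 0)} \<union> {0}"

definition scale_by :: "('k, 'f::field) curve \<Rightarrow> 'k \<Rightarrow> 'f \<Rightarrow> 'f" where
  "scale_by X c h = emb X c * h"

definition ell :: "('k::field, 'f::field) curve \<Rightarrow> 'f divisor \<Rightarrow> nat" where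
  "ell X G = vector_space.dim (scale_by X) (RR_space X G)"

section \<open>Evaluation codes\<close>

text \<open>A closed point is rational iff its residue field is \<open>k\<close>.\<close>

definition rational_points :: "('k, 'f::field) curve \<Rightarrow> 'f set set" where
  "rational_points X = {P \<in> closed_points X. \<forall>f\<in>P. \<exists>c. f - emb X c \<in> max_ideal P}"

definition value_at :: "('k, 'f::field) curve \<Rightarrow> 'f set \<Rightarrow> 'f \<Rightarrow> 'k" where
  "value_at X P h = (THE c. h - emb X c \<in> max_ideal P)"

definition ev :: "('k, 'f::field) curve \<Rightarrow> ('n::finite \<Rightarrow> 'f set) \<Rightarrow> 'f \<Rightarrow> 'k ^ 'n" where
  "ev X P h = (\<chi> i. value_at X (P i) h)"

definition point_sum :: "('n::finite \<Rightarrow> 'f set) \<Rightarrow> 'f divisor" where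
  "point_sum P = (\<Sum>i\<in>UNIV. Poly_Mapping.single (P i) 1)"

text \<open>The code \<open>C\<^sub>L(D, G)\<close> for \<open>D = point_sum P\<close>; the coordinates are numbered by \<open>P\<close>.\<close>

definition AG_code :: "('k, 'f::field) curve \<Rightarrow> ('n::finite \<Rightarrow> 'f set) \<Rightarrow> 'f divisor \<Rightarrow> ('k ^ 'n) set" where
  "AG_code X P G = ev X P ` RR_space X G"

section \<open>Quotients and the excess\<close>

text \<open>
  The quotient of a subspace \<open>U\<close> by a subspace \<open>W \<subseteq> U\<close>, as a vector space of cosets in the style of
  HOL-Algebra (whose \<open>mult\<close> and \<open>one\<close> fields are irrelevant for modules).  Adding \<open>W\<close> in the scalar
  multiplication only matters for the scalar 0.
\<close>

definition quotient_space ::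
    "('k \<Rightarrow> 'v \<Rightarrow> 'v) \<Rightarrow> 'v::ab_group_add set \<Rightarrow> 'v set \<Rightarrow> ('k, 'v set) module" where
  "quotient_space s U W =
     \<lparr>carrier = {u +o W | u. u \<in> U}, mult = undefined, one = undefined,
      zero = W, add = (+), smult = (\<lambda>c C. s c ` C + W)\<rparr>"

text \<open>The field \<open>k\<close> as a HOL-Algebra structure.\<close>

definition scalar_field :: "'k::field ring" where
  "scalar_field = \<lparr>carrier = UNIV, mult = (*), one = 1, zero = 0, add = (+)\<rparr>"

definition R_space :: "('k, 'f::field) curve \<Rightarrow> 'f divisor \<Rightarrow> 'f divisor \<Rightarrow> 'f divisor \<Rightarrow> 'f set" where
  "R_space X D G A = (RR_space X G + RR_space X A) \<inter> RR_space X (div_join G A - D)"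

definition R0_space :: "('k, 'f::field) curve \<Rightarrow> 'f divisor \<Rightarrow> 'f divisor \<Rightarrow> 'f divisor \<Rightarrow> 'f set" where
  "R0_space X D G A = RR_space X (G - D) + RR_space X (A - D)"

definition excess :: "('k::field, 'f::field) curve \<Rightarrow> 'f divisor \<Rightarrow> 'f divisor \<Rightarrow> 'f divisor \<Rightarrow> nat" where
  "excess X D G A =
     vectorspace.dim (scalar_field :: 'k ring)
       (quotient_space (scale_by X) (R_space X D G A) (R0_space X D G A))"

end

theory Submission
  imports Defs
begin

text \<open>
  Neither \<open>G\<close> nor \<open>A\<close> meets \<open>D\<close>, so evaluation at the points of \<open>D\<close> is a linear map on
  \<open>L(G) + L(A)\<close>.  Its kernel on \<open>L(G)\<close> is \<open>L(G - D)\<close>, its kernel on \<open>L(A)\<close> is \<open>L(A - D)\<close>, and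
  since \<open>L(G) + L(A) \<subseteq> L(G \<or> A)\<close>, its kernel on the sum is \<open>R(G, A)\<close>; moreover
  \<open>L(G \<and> A) = L(G) \<inter> L(A)\<close>.  The first three claims are therefore instances of a fact about a
  linear map \<open>f\<close> and two subspaces \<open>U\<close>, \<open>V\<close> (\<open>image_inter_quotient_iso\<close>): a common value
  \<open>f g = f a\<close> with \<open>g \<in> U\<close>, \<open>a \<in> V\<close> yields \<open>g - a\<close> in the kernel of \<open>f\<close> on \<open>U + V\<close>, and this
  identifies \<open>(f U \<inter> f V) / f (U \<inter> V)\<close> with that kernel modulo the part coming from \<open>U\<close> and \<open>V\<close>
  separately.

  The dimension formula is rank-nullity on \<open>L(G \<and> A)\<close> together with this isomorphism, provided that
  \<open>L(G \<and> A)\<close> is finite-dimensional.  Over a finite field a finite-dimensional space is a finite set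
  of \<open>q\<^sup>d\<close> elements, \<open>d\<close> its dimension, so all dimensions are compared by counting, and what
  has to be shown is that Riemann-Roch spaces are finite (\<open>finite_RR_space\<close>).  Raising one
  coefficient of a divisor by one enlarges the space by at most a residue field, which is finite
  (\<open>vanishing_residues\<close>); by induction this reduces the claim to functions without poles.  These
  are constant (\<open>regular_constant\<close>): multiplication by such a function maps the forms of some high
  degree in the homogeneous coordinates to themselves, and these form a finite set, so the function
  is zero or a root of unity; subtracting its value at a rational point makes it a non-unit there,
  which leaves only zero.

  Both the finiteness of residue fields and the existence of the order of vanishing rest on one
  property of a function field of transcendence degree one: any two of its elements are
  algebraically dependent over the constants (\<open>algebraically_dependent\<close>), in the sharper form that
  modulo any \<open>f \<noteq> 0\<close> every \<open>h\<close> satisfies a nontrivial polynomial equation with constant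
  coefficients (\<open>relation_modulo\<close>).
\<close>

section \<open>Quotients of vector spaces\<close>

context vector_space
begin

lemma add_subspace_self: "subspace W \<Longrightarrow> W + W = W"
  by (auto simp: set_plus_def subspace_add) (metis add.right_neutral subspace_0)

lemma coset_eq_iff:
  assumes "subspace W"
  shows "u +o W = v +o W \<longleftrightarrow> u - v \<in> W"
proof
  assume "u +o W = v +o W"
  moreover have "u \<in> u +o W"
    using subspace_0[OF assms] by (force simp: elt_set_plus_def)
  ultimately show "u - v \<in> W"
    by (auto simp: elt_set_plus_def)
next
  assume d: "u - v \<in> W"
  have "\<exists>w'\<in>W. u + w = v + w'" if "w \<in> W" for w
    by (rule bexI[of _ "(u - v) + w"]) (use that d assms in \<open>auto simp: subspace_add\<close>)
  moreover have "\<exists>w'\<in>W. v + w = u + w'" if "w \<in> W" for w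
    by (rule bexI[of _ "w - (u - v)"]) (use that d assms in \<open>auto simp: subspace_diff\<close>)
  ultimately show "u +o W = v +o W"
    by (auto simp: elt_set_plus_def)
qed

lemma coset_self: "subspace W \<Longrightarrow> 0 +o W = W"
  by (simp add: elt_set_plus_def)

lemma coset_add:
  assumes "subspace W"
  shows "(u +o W) + (v +o W) = (u + v) +o W"
  by (simp add: set_plus_rearrange add_subspace_self[OF assms])

lemma coset_scale:
  assumes W: "subspace W"
  shows "scale c ` (u +o W) + W = scale c u +o W"
proof (intro equalityI subsetI)
  fix x assume "x \<in> scale c ` (u +o W) + W"
  then obtain w w' where "w \<in> W" "w' \<in> W" "x = scale c (u + w) + w'"
    by (auto simp: set_plus_def elt_set_plus_def)
  then have "x = scale c u + (scale c w + w')" "scale c w + w' \<in> W"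
    using W by (auto simp: scale_right_distrib add.assoc subspace_add subspace_scale)
  then show "x \<in> scale c u +o W"
    by (auto simp: elt_set_plus_def)
next
  fix x assume "x \<in> scale c u +o W"
  then obtain w where w: "w \<in> W" "x = scale c u + w"
    by (auto simp: elt_set_plus_def)
  moreover have "u \<in> u +o W"
    using subspace_0[OF W] by (force simp: elt_set_plus_def)
  ultimately show "x \<in> scale c ` (u +o W) + W"
    by (auto simp: set_plus_def)
qed

lemma quotient_add:
  "subspace W \<Longrightarrow> (u +o W) \<oplus>\<^bsub>quotient_space scale U W\<^esub> (v +o W) = (u + v) +o W"
  by (simp add: quotient_space_def coset_add)

lemma quotient_scale:
  "subspace W \<Longrightarrow> c \<odot>\<^bsub>quotient_space scale U W\<^esub> (u +o W) = scale c u +o W"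
  by (simp add: quotient_space_def coset_scale)

lemma quotient_zero: "subspace W \<Longrightarrow> \<zero>\<^bsub>quotient_space scale U W\<^esub> = 0 +o W"
  by (simp add: quotient_space_def coset_self)

lemma quotient_carrier: "carrier (quotient_space scale U W) = (\<lambda>u. u +o W) ` U"
  by (auto simp: quotient_space_def)

end

lemma field_scalar_field: "field (scalar_field :: 'k::field ring)"
proof (rule cring.cring_fieldI2)
  show "cring (scalar_field :: 'k ring)"
  proof (rule cringI)
    show "abelian_group (scalar_field :: 'k ring)"
      by (rule abelian_groupI) (auto simp: scalar_field_def intro: exI[of _ "- x" for x])
    show "Group.comm_monoid (scalar_field :: 'k ring)"
      by (rule comm_monoidI) (auto simp: scalar_field_def)
  qed (auto simp: scalar_field_def algebra_simps)
qed (auto simp: scalar_field_def intro: right_inverse)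

lemma (in vector_space) vectorspace_quotient_space:
  assumes U: "subspace U" and W: "subspace W"
  shows "vectorspace scalar_field (quotient_space scale U W)"
proof (rule vs_criteria[OF field_scalar_field])
  let ?Q = "quotient_space scale U W"
  show "\<zero>\<^bsub>?Q\<^esub> \<in> carrier ?Q"
    unfolding quotient_zero[OF W] quotient_carrier using subspace_0[OF U] by blast
  show "\<forall>v\<in>carrier ?Q. \<exists>neg_v\<in>carrier ?Q. v \<oplus>\<^bsub>?Q\<^esub> neg_v = \<zero>\<^bsub>?Q\<^esub>"
  proof
    fix v assume "v \<in> carrier ?Q"
    then obtain u where "u \<in> U" "v = u +o W" by (auto simp: quotient_carrier)
    then show "\<exists>neg_v\<in>carrier ?Q. v \<oplus>\<^bsub>?Q\<^esub> neg_v = \<zero>\<^bsub>?Q\<^esub>"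
      by (intro bexI[of _ "(- u) +o W"])
         (auto simp: quotient_carrier quotient_add[OF W] quotient_zero[OF W] subspace_neg[OF U])
  qed
  show "\<forall>v\<in>carrier ?Q. v \<oplus>\<^bsub>?Q\<^esub> \<zero>\<^bsub>?Q\<^esub> = v"
    by (auto simp only: quotient_carrier quotient_add[OF W] quotient_zero[OF W] add_0_right)
qed (auto simp: quotient_carrier quotient_add[OF W] quotient_zero[OF W] quotient_scale[OF W]
       scalar_field_def subspace_add[OF U] subspace_scale[OF U] algebra_simps)

section \<open>Counting over a finite field\<close>

lemma one_less_CARD_field: "1 < CARD('k::{field,finite})"
  using card_mono[of "UNIV :: 'k set" "{0, 1}"] by simp

lemma CARD_field_power_inject: "CARD('k::{field,finite}) ^ m = CARD('k) ^ n \<longleftrightarrow> m = n"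
  using one_less_CARD_field[where 'k = 'k] by (simp add: power_inject_exp)

text \<open>
  The coordinates in a basis identify the subspace with the functions from the basis to the field.
\<close>
lemma card_subspace:
  fixes s :: "'k::{field,finite} \<Rightarrow> 'v::ab_group_add \<Rightarrow> 'v"
  assumes "vector_space s" and V: "module.subspace s V" and fin: "finite V"
  shows "card V = CARD('k) ^ vector_space.dim s V"
proof -
  interpret vector_space s by fact
  obtain B where B: "B \<subseteq> V" "independent B" "V \<subseteq> span B" "card B = dim V"
    using basis_exists by blast
  have finB: "finite B" using B(1) fin finite_subset by blast
  have span: "span B = V"
    using B V by (metis span_subspace)
  let ?comb = "\<lambda>c. \<Sum>v\<in>B. s (c v) v"
  have "bij_betw ?comb (B \<rightarrow>\<^sub>E UNIV) V"
  proof (rule bij_betwI')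
    fix c d assume c: "c \<in> B \<rightarrow>\<^sub>E (UNIV :: 'k set)" and d: "d \<in> B \<rightarrow>\<^sub>E (UNIV :: 'k set)"
    show "(?comb c = ?comb d) = (c = d)"
    proof
      assume eq: "?comb c = ?comb d"
      have "c v = d v" if "v \<in> B" for v
      proof -
        have "(\<Sum>v\<in>B. s (c v - d v) v) = 0"
          using eq by (simp add: scale_left_diff_distrib sum_subtractf)
        then have "c v - d v = 0"
          using B(2) finB that by (metis dependent_finite)
        then show ?thesis by simp
      qed
      then show "c = d" using c d by (metis PiE_ext)
    qed simp
  next
    fix c assume "c \<in> B \<rightarrow>\<^sub>E (UNIV :: 'k set)"
    show "?comb c \<in> V"
      using span_finite[OF finB] span by blast
  next
    fix x assume "x \<in> V"
    then obtain u where "x = (\<Sum>v\<in>B. s (u v) v)"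
      using span_finite[OF finB] span by blast
    then show "\<exists>c\<in>B \<rightarrow>\<^sub>E UNIV. x = ?comb c"
      by (intro bexI[of _ "restrict u B"]) auto
  qed
  then have "card (B \<rightarrow>\<^sub>E (UNIV :: 'k set)) = card V"
    by (rule bij_betw_same_card)
  then show ?thesis
    using B(4) finB by (simp add: card_PiE)
qed

text \<open>
  The same count for vector spaces given by a carrier set; it lets the two notions of dimension, for
  subspaces of a type and for abstract quotient spaces, be compared through cardinalities.
\<close>
lemma card_carrier_vectorspace:
  fixes Q :: "('k::{field,finite}, 'v) module"
  assumes "vectorspace (scalar_field :: 'k ring) Q" and finQ: "finite (carrier Q)"
  shows "card (carrier Q) = CARD('k) ^ vectorspace.dim (scalar_field :: 'k ring) Q"
proof -
  interpret vectorspace "scalar_field :: 'k ring" Q by fact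
  have "fin_dim"
    unfolding fin_dim_def
    using finQ in_own_span[OF subset_refl] span_is_subset2[OF subset_refl]
    by (intro exI[of _ "carrier Q"] conjI equalityI subset_refl)
  then obtain B where B: "finite B" "basis B"
    using finite_basis_exists by blast
  then have BQ: "B \<subseteq> carrier Q" by (simp add: basis_def)
  have uni: "\<exists>!a. a \<in> B \<rightarrow>\<^sub>E (UNIV :: 'k set) \<and> lincomb a B = v" if "v \<in> carrier Q" for v
    using basis_criterion[OF B(1) BQ] B(2) that by (simp add: scalar_field_def)
  have clo: "lincomb a B \<in> carrier Q" for a
    using BQ by (intro lincomb_closed) (auto simp: scalar_field_def)
  have "bij_betw (\<lambda>a. lincomb a B) (B \<rightarrow>\<^sub>E (UNIV :: 'k set)) (carrier Q)"
    by (rule bij_betwI') (use uni clo in metis)+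
  then have "card (B \<rightarrow>\<^sub>E (UNIV :: 'k set)) = card (carrier Q)"
    by (rule bij_betw_same_card)
  then show ?thesis
    using B dim_basis by (simp add: card_PiE)
qed

text \<open>
  The map \<open>\<phi>\<close> need only separate the cosets of \<open>W\<close>; this covers both the projection to a quotient
  space and a linear map with kernel \<open>W\<close>.
\<close>
lemma (in vector_space) card_fibres:
  assumes U: "subspace U" and "finite U"
    and fibre: "\<And>x y. x \<in> U \<Longrightarrow> y \<in> U \<Longrightarrow> \<phi> x = \<phi> y \<longleftrightarrow> x - y \<in> W" and W: "W \<subseteq> U" "subspace W"
  shows "card U = card W * card (\<phi> ` U)"
proof -
  have "card {x \<in> U. \<phi> x = z} = card W" if z: "z \<in> \<phi> ` U" for z
  proof -
    obtain u where u: "u \<in> U" "z = \<phi> u" using z by blast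
    have "bij_betw (\<lambda>w. u + w) W {x \<in> U. \<phi> x = z}"
    proof (rule bij_betwI')
      fix w assume "w \<in> W"
      then show "u + w \<in> {x \<in> U. \<phi> x = z}"
        using u W fibre[of "u + w" u] U by (auto intro: subspace_add)
    next
      fix x assume "x \<in> {x \<in> U. \<phi> x = z}"
      then show "\<exists>w\<in>W. x = u + w"
        using u fibre[of x u] by (intro bexI[of _ "x - u"]) auto
    qed simp
    then show ?thesis by (rule bij_betw_same_card[symmetric])
  qed
  moreover have "card U = (\<Sum>z\<in>\<phi> ` U. card {x \<in> U. \<phi> x = z})"
    using sum_card_image assms(2) sum.image_gen[OF assms(2), of "\<lambda>_. 1::nat" \<phi>] by simp
  ultimately show ?thesis by simp
qed

lemma dim_quotient:
  fixes s :: "'k::{field,finite} \<Rightarrow> 'v::ab_group_add \<Rightarrow> 'v"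
  assumes "vector_space s" and U: "module.subspace s U" and W: "module.subspace s W"
    and "W \<subseteq> U" and fin: "finite U"
  shows "vector_space.dim s U =
    vector_space.dim s W + vectorspace.dim (scalar_field :: 'k ring) (quotient_space s U W)"
proof -
  interpret vector_space s by fact
  let ?Q = "quotient_space s U W"
  have "card U = card W * card (carrier ?Q)"
    unfolding quotient_carrier
    by (rule card_fibres[OF U fin _ \<open>W \<subseteq> U\<close> W]) (rule coset_eq_iff[OF W])
  moreover have "card (carrier ?Q) = CARD('k) ^ vectorspace.dim (scalar_field :: 'k ring) ?Q"
    using fin by (intro card_carrier_vectorspace vectorspace_quotient_space U W)
      (simp add: quotient_carrier)
  moreover have "finite W" using fin \<open>W \<subseteq> U\<close> finite_subset by blast
  ultimately have "CARD('k) ^ dim U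
      = CARD('k) ^ (dim W + vectorspace.dim (scalar_field :: 'k ring) ?Q)"
    using card_subspace[OF assms(1)] U W fin by (simp add: power_add)
  then show ?thesis by (simp only: CARD_field_power_inject)
qed

lemma dim_image_kernel:
  fixes s\<^sub>1 :: "'k::{field,finite} \<Rightarrow> 'v::ab_group_add \<Rightarrow> 'v" and s\<^sub>2 :: "'k \<Rightarrow> 'w::ab_group_add \<Rightarrow> 'w"
  assumes vs1: "vector_space s\<^sub>1" and vs2: "vector_space s\<^sub>2"
    and T: "module.subspace s\<^sub>1 T" "finite T"
    and K: "module.subspace s\<^sub>1 {x \<in> T. f x = 0}" and im: "module.subspace s\<^sub>2 (f ` T)"
    and add: "\<And>x y. x \<in> T \<Longrightarrow> y \<in> T \<Longrightarrow> f (x + y) = f x + f y"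
  shows "vector_space.dim s\<^sub>1 T = vector_space.dim s\<^sub>1 {x \<in> T. f x = 0} + vector_space.dim s\<^sub>2 (f ` T)"
proof -
  interpret v1: vector_space s\<^sub>1 by fact
  have "f x = f y \<longleftrightarrow> x - y \<in> {x \<in> T. f x = 0}" if "x \<in> T" "y \<in> T" for x y
    using that add[of "x - y" y] v1.subspace_diff[OF T(1)] by auto
  then have "card T = card {x \<in> T. f x = 0} * card (f ` T)"
    by (intro v1.card_fibres T K) auto
  then have "CARD('k) ^ vector_space.dim s\<^sub>1 T
      = CARD('k) ^ (vector_space.dim s\<^sub>1 {x \<in> T. f x = 0} + vector_space.dim s\<^sub>2 (f ` T))"
    using card_subspace[OF vs1 T] card_subspace[OF vs1 K] card_subspace[OF vs2 im] T(2)
    by (simp add: power_add)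
  then show ?thesis by (simp only: CARD_field_power_inject)
qed

section \<open>Intersecting the images of two subspaces\<close>

text \<open>
  If \<open>f x = f y\<close> with \<open>x \<in> U\<close> and \<open>y \<in> V\<close>, then \<open>f x\<close> comes from some \<open>w \<in> U \<inter> V\<close> iff
  \<open>x - y = (x - w) + (w - y)\<close> splits into a kernel element of \<open>U\<close> and one of \<open>V\<close>.  Applied to
  differences of two choices, this says at once that \<open>f g = f a \<mapsto> g - a\<close> is well defined and injective
  on cosets.  It is onto, since \<open>x + y\<close> in the kernel comes from \<open>f x = f (- y)\<close>.  Linearity of
  \<open>f\<close> is required on \<open>U + V\<close> only, because evaluation has no meaning on functions with poles.
\<close>
lemma image_inter_quotient_iso:
  fixes s\<^sub>1 :: "'k::field \<Rightarrow> 'v::ab_group_add \<Rightarrow> 'v" and s\<^sub>2 :: "'k \<Rightarrow> 'w::ab_group_add \<Rightarrow> 'w"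
    and f :: "'v \<Rightarrow> 'w"
  assumes vs1: "vector_space s\<^sub>1" and vs2: "vector_space s\<^sub>2"
    and U: "module.subspace s\<^sub>1 U" and V: "module.subspace s\<^sub>1 V"
    and add: "\<And>x y. x \<in> U + V \<Longrightarrow> y \<in> U + V \<Longrightarrow> f (x + y) = f x + f y"
    and scale: "\<And>c x. x \<in> U + V \<Longrightarrow> f (s\<^sub>1 c x) = s\<^sub>2 c (f x)"
  defines "I \<equiv> f ` U \<inter> f ` V" and "J \<equiv> f ` (U \<inter> V)"
    and "R \<equiv> {x \<in> U + V. f x = 0}" and "R0 \<equiv> {x \<in> U. f x = 0} + {x \<in> V. f x = 0}"
  shows "module.subspace s\<^sub>2 I" and "module.subspace s\<^sub>2 J"
    and "module.subspace s\<^sub>1 R" and "module.subspace s\<^sub>1 R0"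
    and "\<exists>\<phi>. linear_map scalar_field (quotient_space s\<^sub>2 I J) (quotient_space s\<^sub>1 R R0) \<phi> \<and>
           bij_betw \<phi> (carrier (quotient_space s\<^sub>2 I J)) (carrier (quotient_space s\<^sub>1 R R0)) \<and>
           (\<forall>g\<in>U. \<forall>a\<in>V. f g = f a \<longrightarrow> \<phi> (f g +o J) = (g - a) +o R0)"
proof -
  interpret v1: vector_space s\<^sub>1 by fact
  interpret v2: vector_space s\<^sub>2 by fact
  note sub1 = v1.subspace_add v1.subspace_scale v1.subspace_0 v1.subspace_diff
  have sums: "v1.subspace (S + T)" if "v1.subspace S" "v1.subspace T" for S T
  proof -
    have "S + T = {x + y | x y. x \<in> S \<and> y \<in> T}" by (auto simp: set_plus_def)
    then show ?thesis using v1.subspace_sums[OF that] by simp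
  qed
  have UV: "v1.subspace (U + V)" by (rule sums[OF U V])
  have inU: "x \<in> U + V" if "x \<in> U" for x
    using set_plus_intro[OF that v1.subspace_0[OF V]] by simp
  have inV: "x \<in> U + V" if "x \<in> V" for x
    using set_plus_intro[OF v1.subspace_0[OF U] that] by simp
  have f0: "f 0 = 0"
    using scale[OF v1.subspace_0[OF UV], of 0] by simp
  have diff: "f (x - y) = f x - f y" if "x \<in> U + V" "y \<in> U + V" for x y
    using add[of "x - y" y] that v1.subspace_diff[OF UV] by (simp add: eq_diff_eq)
  have image: "v2.subspace (f ` T)" if "v1.subspace T" "T \<subseteq> U + V" for T
  proof (rule v2.subspaceI)
    show "0 \<in> f ` T" using f0 v1.subspace_0[OF that(1)] by (metis image_eqI)
  next
    fix x y assume "x \<in> f ` T" "y \<in> f ` T"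
    then obtain x' y' where "x' \<in> T" "y' \<in> T" "x = f x'" "y = f y'" by blast
    then show "x + y \<in> f ` T"
      using that add[of x' y'] v1.subspace_add[OF that(1)] by (metis image_eqI subsetD)
  next
    fix c x assume "x \<in> f ` T"
    then obtain x' where "x' \<in> T" "x = f x'" by blast
    then show "s\<^sub>2 c x \<in> f ` T"
      using that scale[of x' c] v1.subspace_scale[OF that(1)] by (metis image_eqI subsetD)
  qed
  have kernel: "v1.subspace {x \<in> T. f x = 0}" if "v1.subspace T" "T \<subseteq> U + V" for T
    using that by (intro v1.subspaceI) (auto simp: f0 add scale subset_iff sub1)
  have sub: "U \<subseteq> U + V" "V \<subseteq> U + V" using inU inV by auto
  show I: "v2.subspace I" unfolding I_def by (intro v2.subspace_inter image U V sub)
  show J: "v2.subspace J" unfolding J_def by (intro image v1.subspace_inter U V) (use sub in auto)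
  show R: "v1.subspace R" unfolding R_def by (intro kernel UV subset_refl)
  show R0: "v1.subspace R0" unfolding R0_def by (intro sums kernel U V sub)
  \<comment> \<open>The criterion behind well-definedness and injectivity.\<close>
  have key: "f x \<in> J \<longleftrightarrow> x - y \<in> R0" if x: "x \<in> U" and y: "y \<in> V" and xy: "f x = f y" for x y
  proof
    assume "f x \<in> J"
    then obtain w where w: "w \<in> U" "w \<in> V" "f x = f w" by (auto simp: J_def)
    then have "x - w \<in> {x \<in> U. f x = 0}" "w - y \<in> {x \<in> V. f x = 0}"
      using x y xy inU inV by (auto simp: diff sub1 U V)
    from set_plus_intro[OF this] show "x - y \<in> R0" by (simp add: R0_def)
  next
    assume "x - y \<in> R0"
    then obtain u v where uv: "u \<in> U" "f u = 0" "v \<in> V" "f v = 0" "x - y = u + v"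
      by (auto simp: R0_def set_plus_def)
    then have "x - u = y + v" by (simp add: algebra_simps)
    moreover have "x - u \<in> U" "y + v \<in> V" using x y uv by (simp_all add: sub1 U V)
    moreover have "f (x - u) = f x" using x uv inU by (simp add: diff)
    ultimately show "f x \<in> J" unfolding J_def by (metis IntI image_eqI)
  qed
  have coset: "f g +o J = f g' +o J \<longleftrightarrow> (g - a) +o R0 = (g' - a') +o R0"
    if "g \<in> U" "a \<in> V" "f g = f a" "g' \<in> U" "a' \<in> V" "f g' = f a'" for g a g' a'
  proof -
    have "f (g - g') = f (a - a')" using that inU inV by (simp add: diff)
    from key[OF _ _ this] show ?thesis
      using that inU by (simp add: v1.coset_eq_iff[OF R0] v2.coset_eq_iff[OF J] diff sub1 U V algebra_simps)
  qed
  define \<phi> where "\<phi> = (\<lambda>C. THE r. \<exists>g\<in>U. \<exists>a\<in>V. f g = f a \<and> C = f g +o J \<and> r = (g - a) +o R0)"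
  have \<phi>: "\<phi> (f g +o J) = (g - a) +o R0" if "g \<in> U" "a \<in> V" "f g = f a" for g a
    unfolding \<phi>_def
  proof (rule the_equality)
    show "\<exists>g'\<in>U. \<exists>a'\<in>V. f g' = f a' \<and> f g +o J = f g' +o J \<and> (g - a) +o R0 = (g' - a') +o R0"
      using that by blast
  next
    fix r assume "\<exists>g'\<in>U. \<exists>a'\<in>V. f g' = f a' \<and> f g +o J = f g' +o J \<and> r = (g' - a') +o R0"
    then show "r = (g - a) +o R0" using coset that by metis
  qed
  let ?QC = "quotient_space s\<^sub>2 I J" and ?QR = "quotient_space s\<^sub>1 R R0"
  have QC: "\<exists>g\<in>U. \<exists>a\<in>V. f g = f a \<and> C = f g +o J" if "C \<in> carrier ?QC" for C
    using that by (auto simp: v2.quotient_carrier I_def)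
  have QR: "(g - a) +o R0 \<in> carrier ?QR" if "g \<in> U" "a \<in> V" "f g = f a" for g a
    using that inU inV by (auto simp: v1.quotient_carrier R_def diff v1.subspace_diff[OF UV])
  have "linear_map scalar_field ?QC ?QR \<phi>"
  proof -
    have "\<phi> \<in> LinearCombinations.module_hom scalar_field ?QC ?QR"
      unfolding LinearCombinations.module_hom_def
    proof (intro CollectI conjI allI impI ballI funcsetI)
      fix C assume "C \<in> carrier ?QC"
      then show "\<phi> C \<in> carrier ?QR" using QC \<phi> QR by metis
    next
      fix C C' assume "C \<in> carrier ?QC \<and> C' \<in> carrier ?QC"
      then obtain g a g' a' where *: "g \<in> U" "a \<in> V" "f g = f a" "C = f g +o J"
         "g' \<in> U" "a' \<in> V" "f g' = f a'" "C' = f g' +o J" using QC by metis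
      then have "\<phi> (f (g + g') +o J) = (g + g' - (a + a')) +o R0"
        by (intro \<phi>) (auto simp: sub1 U V add inU inV)
      moreover have "C \<oplus>\<^bsub>?QC\<^esub> C' = f (g + g') +o J"
        using * by (simp add: v2.quotient_add[OF J] add inU)
      moreover have "\<phi> C = (g - a) +o R0" "\<phi> C' = (g' - a') +o R0"
        using * \<phi> by metis+
      ultimately show "\<phi> (C \<oplus>\<^bsub>?QC\<^esub> C') = \<phi> C \<oplus>\<^bsub>?QR\<^esub> \<phi> C'"
        by (simp add: v1.quotient_add[OF R0] algebra_simps)
    next
      fix c C assume "c \<in> carrier (scalar_field :: 'k ring) \<and> C \<in> carrier ?QC"
      then obtain g a where *: "g \<in> U" "a \<in> V" "f g = f a" "C = f g +o J" using QC by metis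
      then have "\<phi> (f (s\<^sub>1 c g) +o J) = (s\<^sub>1 c g - s\<^sub>1 c a) +o R0"
        by (intro \<phi>) (auto simp: sub1 U V scale inU inV)
      moreover have "c \<odot>\<^bsub>?QC\<^esub> C = f (s\<^sub>1 c g) +o J"
        using * by (simp add: v2.quotient_scale[OF J] scale inU)
      moreover have "\<phi> C = (g - a) +o R0" using * \<phi> by metis
      ultimately show "\<phi> (c \<odot>\<^bsub>?QC\<^esub> C) = c \<odot>\<^bsub>?QR\<^esub> \<phi> C"
        by (simp add: v1.quotient_scale[OF R0] v1.scale_right_diff_distrib)
    qed
    then show ?thesis
      using v1.vectorspace_quotient_space[OF R R0] v2.vectorspace_quotient_space[OF I J]
      by (simp add: linear_map_def mod_hom_def mod_hom_axioms_def vectorspace_def)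
  qed
  moreover have "bij_betw \<phi> (carrier ?QC) (carrier ?QR)"
  proof (rule bij_betwI')
    fix C C' assume "C \<in> carrier ?QC" "C' \<in> carrier ?QC"
    then obtain g a g' a' where "g \<in> U" "a \<in> V" "f g = f a" "C = f g +o J"
      "g' \<in> U" "a' \<in> V" "f g' = f a'" "C' = f g' +o J" using QC by metis
    then show "\<phi> C = \<phi> C' \<longleftrightarrow> C = C'" using \<phi> coset by metis
  next
    fix C assume "C \<in> carrier ?QC"
    then show "\<phi> C \<in> carrier ?QR" using QC \<phi> QR by metis
  next
    fix r assume "r \<in> carrier ?QR"
    then obtain x y where xy: "x \<in> U" "y \<in> V" "f (x + y) = 0" "r = (x + y) +o R0"
      by (auto simp: v1.quotient_carrier R_def elim!: set_plus_elim)
    have "f (- y) = - f y" using diff[OF v1.subspace_0[OF UV] inV[OF xy(2)]] by (simp add: f0)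
    moreover have "f x + f y = 0" using xy add[OF inU[OF xy(1)] inV[OF xy(2)]] by simp
    ultimately have eq: "f x = f (- y)" by (metis add.left_neutral add_diff_cancel_right' diff_0)
    have "- y \<in> V" using xy V v1.subspace_neg by blast
    then have "\<phi> (f x +o J) = r"
      using \<phi>[OF xy(1) _ eq] xy by simp
    moreover have "f x \<in> I"
      using xy(1) \<open>- y \<in> V\<close> eq unfolding I_def by (metis IntI image_eqI)
    then have "f x +o J \<in> carrier ?QC" by (simp add: v2.quotient_carrier)
    ultimately show "\<exists>C\<in>carrier ?QC. r = \<phi> C" by metis
  qed
  ultimately show "\<exists>\<phi>. linear_map scalar_field ?QC ?QR \<phi> \<and> bij_betw \<phi> (carrier ?QC) (carrier ?QR) \<and>
      (\<forall>g\<in>U. \<forall>a\<in>V. f g = f a \<longrightarrow> \<phi> (f g +o J) = (g - a) +o R0)"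
    using \<phi> by blast
qed

section \<open>Algebraic dependence in a function field\<close>

text \<open>
  A field extension \<open>e\<close> of a finite field.  The larger field is a vector space over the smaller one,
  and finitely generated subspaces are finite sets.
\<close>

locale finite_constants =
  fixes e :: "'k::{field,finite} \<Rightarrow> 'f::field"
  assumes e_1: "e 1 = 1" and e_add: "e (a + b) = e a + e b" and e_mult: "e (a * b) = e a * e b"
begin

lemma e_0 [simp]: "e 0 = 0"
  using e_add[of 0 0] by (metis add_0 add_right_imp_eq)

lemma e_diff: "e (a - b) = e a - e b"
  using e_add[of "a - b" b] by (simp add: eq_diff_eq)

lemma e_eq_0_iff [simp]: "e a = 0 \<longleftrightarrow> a = 0"
proof
  assume "e a = 0"
  then show "a = 0"
    using e_mult[of a "inverse a"] e_1 by (cases "a = 0") auto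
qed simp

sublocale vs: vector_space "\<lambda>c h. e c * h"
  by unfold_locales (auto simp: algebra_simps e_1 e_add e_mult)

lemma alg_0: "0 \<in> generated_algebra e S"
  using generated_algebra.const[of e 0 S] by simp

lemma alg_1: "1 \<in> generated_algebra e S"
  using generated_algebra.const[of e 1 S] by (simp add: e_1)

lemma alg_subspace: "vs.subspace (generated_algebra e S)"
  by (intro vs.subspaceI) (auto intro: generated_algebra.intros alg_0)

lemmas alg_neg = vs.subspace_neg[OF alg_subspace]
  and alg_diff = vs.subspace_diff[OF alg_subspace]
  and alg_sum = vs.subspace_sum[OF alg_subspace]

lemma alg_power: "a \<in> generated_algebra e S \<Longrightarrow> a ^ n \<in> generated_algebra e S"
  by (induction n) (auto intro: alg_1 generated_algebra.mult)

lemma alg_subset: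
  assumes "S \<subseteq> T" "range e \<subseteq> T" "\<And>a b. a \<in> T \<Longrightarrow> b \<in> T \<Longrightarrow> a + b \<in> T"
    "\<And>a b. a \<in> T \<Longrightarrow> b \<in> T \<Longrightarrow> a * b \<in> T"
  shows "generated_algebra e S \<subseteq> T"
proof
  fix x assume "x \<in> generated_algebra e S"
  then show "x \<in> T" by induction (use assms in auto)
qed

lemma span_mult:
  assumes "\<And>a b. a \<in> A \<Longrightarrow> b \<in> B \<Longrightarrow> a * b \<in> vs.span C"
    and "x \<in> vs.span A" "z \<in> vs.span B"
  shows "x * z \<in> vs.span C"
proof -
  have "a * z \<in> vs.span C" if a: "a \<in> A" for a
    using assms(3)
  proof (induction rule: vs.span_induct_alt)
    case (step c b z)
    have "e c * (a * b) + a * z \<in> vs.span C"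
      using step assms(1)[OF a] by (intro vs.span_add vs.span_scale) auto
    then show ?case by (simp add: algebra_simps)
  qed (simp add: vs.span_zero)
  with assms(2) show ?thesis
  proof (induction rule: vs.span_induct_alt)
    case (step c b x)
    have "e c * (b * z) + x * z \<in> vs.span C"
      using step by (intro vs.span_add vs.span_scale) auto
    then show ?case by (simp add: algebra_simps)
  qed (simp add: vs.span_zero)
qed

lemma span_mult_left:
  assumes "\<And>b. b \<in> B \<Longrightarrow> a * b \<in> vs.span C" and "z \<in> vs.span B"
  shows "a * z \<in> vs.span C"
  by (rule span_mult[where A = "{a}" and B = B]) (use assms in \<open>auto intro: vs.span_base\<close>)

lemma card_span_le:
  assumes "finite B"
  shows "finite (vs.span B)" and "card (vs.span B) \<le> CARD('k) ^ card B"
proof -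
  have span: "vs.span B = (\<lambda>c. \<Sum>v\<in>B. e (c v) * v) ` (B \<rightarrow>\<^sub>E UNIV)"
  proof -
    have "(\<Sum>v\<in>B. e (c v) * v) = (\<Sum>v\<in>B. e (restrict c B v) * v)" for c
      by (rule sum.cong) auto
    moreover have "restrict c B \<in> B \<rightarrow>\<^sub>E UNIV" for c :: "'f \<Rightarrow> 'k" by auto
    ultimately show ?thesis unfolding vs.span_finite[OF assms] by blast
  qed
  have fin: "finite (B \<rightarrow>\<^sub>E (UNIV :: 'k set))" using assms by (simp add: finite_PiE)
  show "finite (vs.span B)" unfolding span by (rule finite_imageI[OF fin])
  have "card (vs.span B) \<le> card (B \<rightarrow>\<^sub>E (UNIV :: 'k set))"
    unfolding span by (rule card_image_le[OF fin])
  then show "card (vs.span B) \<le> CARD('k) ^ card B" using assms by (simp add: card_PiE)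
qed

lemma alg_singleton_span:
  assumes "p \<in> generated_algebra e {y}"
  shows "\<exists>m. \<forall>n\<ge>m. p \<in> vs.span ((\<lambda>r. y ^ r) ` {..n})"
  using assms
proof induction
  case (const c)
  have "e c * y ^ 0 \<in> vs.span ((\<lambda>r. y ^ r) ` {..n})" for n
    by (intro vs.span_scale vs.span_base) (rule image_eqI[of _ _ 0]; simp)
  then show ?case by auto
next
  case (gen s)
  have "y ^ 1 \<in> vs.span ((\<lambda>r. y ^ r) ` {..n})" if "n \<ge> 1" for n
    using that by (intro vs.span_base imageI) auto
  then show ?case using gen by auto
next
  case (add a b)
  then obtain m m' where "\<forall>n\<ge>m. a \<in> vs.span ((\<lambda>r. y ^ r) ` {..n})"
    "\<forall>n\<ge>m'. b \<in> vs.span ((\<lambda>r. y ^ r) ` {..n})" by blast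
  then show ?case by (intro exI[of _ "max m m'"]) (auto intro: vs.span_add)
next
  case (mult a b)
  then obtain m m' where m: "\<forall>n\<ge>m. a \<in> vs.span ((\<lambda>r. y ^ r) ` {..n})"
    "\<forall>n\<ge>m'. b \<in> vs.span ((\<lambda>r. y ^ r) ` {..n})" by blast
  have "a * b \<in> vs.span ((\<lambda>r. y ^ r) ` {..n})" if n: "n \<ge> m + m'" for n
  proof (rule span_mult)
    show "a \<in> vs.span ((\<lambda>r. y ^ r) ` {..m})" "b \<in> vs.span ((\<lambda>r. y ^ r) ` {..m'})" using m by auto
    show "u * v \<in> vs.span ((\<lambda>r. y ^ r) ` {..n})"
      if uv: "u \<in> (\<lambda>r. y ^ r) ` {..m}" "v \<in> (\<lambda>r. y ^ r) ` {..m'}" for u v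
    proof -
      obtain i j where "i \<le> m" "j \<le> m'" "u * v = y ^ (i + j)"
        using uv by (auto simp: power_add)
      then show ?thesis using n by (auto intro!: vs.span_base)
    qed
  qed
  then show ?case by blast
qed

lemma clear_denominators:
  assumes "finite I" and "\<And>i. i \<in> I \<Longrightarrow> a i \<in> localize (generated_algebra e S) {0}"
  shows "\<exists>s\<in>generated_algebra e S. s \<noteq> 0 \<and> (\<forall>i\<in>I. s * a i \<in> generated_algebra e S)"
  using assms
proof (induction I)
  case empty
  then show ?case using alg_1 by (intro bexI[of _ 1]) auto
next
  case (insert j I)
  then obtain s where s: "s \<in> generated_algebra e S" "s \<noteq> 0" "\<forall>i\<in>I. s * a i \<in> generated_algebra e S"
    by auto
  obtain b t where t: "a j = b / t" "b \<in> generated_algebra e S" "t \<in> generated_algebra e S" "t \<noteq> 0"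
    using insert.prems[of j] by (auto simp: localize_def)
  have "s * t * a i \<in> generated_algebra e S" if "i \<in> insert j I" for i
  proof (cases "i = j")
    case True
    then have "s * t * a i = s * b" using t by simp
    then show ?thesis using s t generated_algebra.mult by metis
  next
    case False
    then have "t * (s * a i) \<in> generated_algebra e S"
      using that s t by (auto intro: generated_algebra.mult)
    then show ?thesis by (simp add: mult.left_commute mult.assoc mult.commute)
  qed
  then show ?case using s t by (intro bexI[of _ "s * t"]) (auto intro: generated_algebra.mult)
qed

text \<open>
  The form in which algebraicity over \<open>k(y)\<close> is used: after clearing denominators, a multiple of \<open>h ^ d\<close>
  by a polynomial in \<open>y\<close> is a combination of lower powers of \<open>h\<close> with coefficients in \<open>k[y]\<close>.
\<close>
lemma algebraic_relation:
  assumes "algebraic_over (localize (generated_algebra e {y}) {0}) h"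
  obtains d p where "p d \<noteq> 0" "d > 0" "\<And>i. p i \<in> generated_algebra e {y}"
    "p d * h ^ d = - (\<Sum>i<d. p i * h ^ i)"
proof -
  obtain q where q: "q \<noteq> 0" "\<And>i. coeff q i \<in> localize (generated_algebra e {y}) {0}" "poly q h = 0"
    using assms by (auto simp: algebraic_over_def)
  obtain s where s: "s \<noteq> 0" "\<And>i. i \<le> degree q \<Longrightarrow> s * coeff q i \<in> generated_algebra e {y}"
    using clear_denominators[of "{..degree q}" "coeff q" "{y}"] q(2) by auto
  define d where "d = degree q"
  have "(\<Sum>i\<le>d. s * coeff q i * h ^ i) = 0"
    using q(3) by (simp add: poly_altdef d_def sum_distrib_left[symmetric] mult.assoc)
  then have "s * coeff q d * h ^ d = - (\<Sum>i<d. s * coeff q i * h ^ i)"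
    by (simp add: lessThan_Suc_atMost[symmetric] add_eq_0_iff2)
  moreover have "s * coeff q d \<noteq> 0" using s q by (simp add: d_def)
  moreover from calculation have "d > 0" by (cases d) auto
  moreover have "s * coeff q i \<in> generated_algebra e {y}" for i
    using s(2)[of i] by (cases "i \<le> degree q") (auto simp: coeff_eq_0 alg_0)
  ultimately show thesis using that[of "\<lambda>i. s * coeff q i" d] by blast
qed

text \<open>
  The combinations of the elements of \<open>M\<close> whose coefficients are polynomials in \<open>y\<close> of degree at most \<open>n\<close>.
  For finite \<open>M\<close> the dimension of this space grows at most linearly with \<open>n\<close>.
\<close>
definition layer :: "'f \<Rightarrow> 'f set \<Rightarrow> nat \<Rightarrow> 'f set" where
  "layer y M n = vs.span ((\<lambda>(r, m). y ^ r * m) ` ({..n} \<times> M))"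

lemma layer_base: "r \<le> n \<Longrightarrow> m \<in> M \<Longrightarrow> y ^ r * m \<in> layer y M n"
  unfolding layer_def by (intro vs.span_base) force

lemma layer_mult_polynomial:
  assumes "p \<in> vs.span ((\<lambda>r. y ^ r) ` {..m})" and "w \<in> layer y M n"
  shows "p * w \<in> layer y M (m + n)"
  unfolding layer_def
proof (rule span_mult[OF _ assms(1) assms(2)[unfolded layer_def]])
  fix u v assume "u \<in> (\<lambda>r. y ^ r) ` {..m}" "v \<in> (\<lambda>(r, m). y ^ r * m) ` ({..n} \<times> M)"
  then obtain i j z where "i \<le> m" "j \<le> n" "z \<in> M" "u * v = y ^ (i + j) * z"
    by (auto simp: power_add mult.assoc)
  then show "u * v \<in> vs.span ((\<lambda>(r, m). y ^ r * m) ` ({..m + n} \<times> M))"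
    using layer_base[of "i + j" "m + n" z M y] by (simp add: layer_def)
qed

text \<open>
  Multiplication by an element \<open>h\<close> that is algebraic over \<open>k(y)\<close> costs only a bounded amount of degree
  in \<open>y\<close>, once the leading coefficient \<open>p d\<close> of its equation is used as a denominator: the first
  powers of \<open>h\<close> stay inside \<open>M\<close>, and the power \<open>h ^ d\<close> is rewritten by the equation.
\<close>
lemma layer_mult_algebraic:
  assumes p: "d > 0" "\<And>i. p i \<in> generated_algebra e {y}" "p d * h ^ d = - (\<Sum>i<d. p i * h ^ i)"
    and M: "M = (\<lambda>(i, z). h ^ i * z) ` ({..<d} \<times> Z)"
  shows "\<exists>C. \<forall>n. \<forall>w\<in>layer y M n. p d * h * w \<in> layer y M (C + n) \<and> p d * w \<in> layer y M (C + n)"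
proof -
  have "\<forall>i. \<exists>m. \<forall>n\<ge>m. p i \<in> vs.span ((\<lambda>r. y ^ r) ` {..n})"
    using alg_singleton_span[OF p(2)] by blast
  then obtain m where m: "\<And>i n. n \<ge> m i \<Longrightarrow> p i \<in> vs.span ((\<lambda>r. y ^ r) ` {..n})" by metis
  define C where "C = Max (m ` {..d})"
  have C: "p i \<in> vs.span ((\<lambda>r. y ^ r) ` {..C})" if "i \<le> d" for i
    using that by (intro m) (simp add: C_def)
  have "p d * h * w \<in> layer y M (C + n)" if w: "w \<in> layer y M n" for w n
    unfolding layer_def
  proof (rule span_mult_left[OF _ w[unfolded layer_def]])
    fix b assume "b \<in> (\<lambda>(r, m). y ^ r * m) ` ({..n} \<times> M)"
    then obtain r i z where b: "r \<le> n" "i < d" "z \<in> Z" "b = y ^ r * (h ^ i * z)"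
      unfolding M by auto
    have base: "y ^ r * (h ^ j * z) \<in> layer y M n" if "j < d" for j
      using b that by (intro layer_base) (auto simp: M)
    have "p d * h * b \<in> layer y M (C + n)"
    proof (cases "Suc i < d")
      case True
      have "p d * h * b = p d * (y ^ r * (h ^ Suc i * z))" by (simp add: b mult_ac)
      then show ?thesis using layer_mult_polynomial[OF C[OF order_refl] base[OF True]] by metis
    next
      case False
      then have "d = Suc i" using b by simp
      then have "p d * h * b = (p d * h ^ d) * (y ^ r * z)" by (simp add: b mult_ac)
      also have "\<dots> = (\<Sum>j<d. - (p j * (y ^ r * (h ^ j * z))))"
        by (simp add: p(3) sum_distrib_left sum_negf mult_ac)
      also have "\<dots> \<in> layer y M (C + n)"
        unfolding layer_def
        using layer_mult_polynomial[OF C base] by (intro vs.span_sum vs.span_neg) (simp add: layer_def)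
      finally show ?thesis .
    qed
    then show "p d * h * b \<in> vs.span ((\<lambda>(r, m). y ^ r * m) ` ({..C + n} \<times> M))"
      by (simp add: layer_def)
  qed
  then show ?thesis using layer_mult_polynomial[OF C] by blast
qed

text \<open>
  A growth argument.  With a common denominator \<open>Q\<close>, the \<open>(N + 1)\<^sup>2\<close> monomials \<open>f\<^sup>i h\<^sup>j\<close> with
  \<open>i, j \<le> N\<close>, multiplied by a power of \<open>Q\<close>, all lie in one layer of index linear in \<open>N\<close>, hence in a
  space whose dimension is linear in \<open>N\<close>.  For large \<open>N\<close> there are more coefficient vectors than
  elements of that space, so two of them give the same combination.
\<close>
lemma algebraically_dependent:
  assumes alg: "\<And>h. algebraic_over (localize (generated_algebra e {y}) {0}) h"
  shows "\<exists>N c. (\<exists>i\<le>N. \<exists>j\<le>N. c i j \<noteq> 0) \<and> (\<Sum>i\<le>N. f ^ i * (\<Sum>j\<le>N. e (c i j) * h ^ j)) = 0"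
proof -
  obtain d p where p: "p d \<noteq> 0" "d > 0" "\<And>i. p i \<in> generated_algebra e {y}"
    "p d * f ^ d = - (\<Sum>i<d. p i * f ^ i)" using algebraic_relation[OF alg[of f]] by blast
  obtain d' p' where p': "p' d' \<noteq> 0" "d' > 0" "\<And>i. p' i \<in> generated_algebra e {y}"
    "p' d' * h ^ d' = - (\<Sum>i<d'. p' i * h ^ i)" using algebraic_relation[OF alg[of h]] by blast
  define M where "M = (\<lambda>(i, z). f ^ i * z) ` ({..<d} \<times> ((\<lambda>j. h ^ j) ` {..<d'}))"
  have M': "M = (\<lambda>(i, z). h ^ i * z) ` ({..<d'} \<times> ((\<lambda>j. f ^ j) ` {..<d}))"
    unfolding M_def by (auto simp: image_iff mult.commute) 
  let ?W = "layer y M"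
  obtain C where C: "\<And>n w. w \<in> ?W n \<Longrightarrow> p d * f * w \<in> ?W (C + n) \<and> p d * w \<in> ?W (C + n)"
    using layer_mult_algebraic[OF p(2-4) M_def] by blast
  obtain C' where C': "\<And>n w. w \<in> ?W n \<Longrightarrow> p' d' * h * w \<in> ?W (C' + n) \<and> p' d' * w \<in> ?W (C' + n)"
    using layer_mult_algebraic[OF p'(2-4) M'] by blast
  define Q where "Q = p d * p' d'"
  define E where "E = C + C'"
  have Q0: "Q \<noteq> 0" using p p' by (simp add: Q_def)
  have step: "Q * f * w \<in> ?W (E + n)" "Q * h * w \<in> ?W (E + n)" "Q * w \<in> ?W (E + n)"
    if w: "w \<in> ?W n" for w n
  proof -
    show "Q * f * w \<in> ?W (E + n)"
      using C[of "p' d' * w" "C' + n"] C'[OF w] by (simp add: Q_def E_def mult_ac add_ac)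
    show "Q * h * w \<in> ?W (E + n)"
      using C[of "p' d' * h * w" "C' + n"] C'[OF w] by (simp add: Q_def E_def mult_ac add_ac)
    show "Q * w \<in> ?W (E + n)"
      using C[of "p' d' * w" "C' + n"] C'[OF w] by (simp add: Q_def E_def mult_ac add_ac)
  qed
  have pow: "(Q * f) ^ i * ((Q * h) ^ j * (Q ^ l * 1)) \<in> ?W (i * E + (j * E + l * E))" for i j l
  proof -
    have one: "1 \<in> ?W 0"
      using layer_base[of 0 0 1 M y] p p' by (force simp: M_def image_iff)
    have l: "Q ^ l * 1 \<in> ?W (l * E)"
      using one by (induction l) (auto dest: step simp: mult.assoc)
    have j: "(Q * h) ^ j * (Q ^ l * 1) \<in> ?W (j * E + l * E)"
    proof (induction j)
      case (Suc j)
      from step(2)[OF Suc] show ?case by (simp add: mult_ac add_ac)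
    qed (use l in simp)
    show ?thesis
    proof (induction i)
      case (Suc i)
      from step(1)[OF this] show ?case by (simp add: mult_ac add_ac)
    qed (use j in simp)
  qed
  \<comment> \<open>This makes the number \<open>(2 * N * E + 1) * (d * d')\<close> of spanning elements at most \<open>(N + 1) * N\<close>.\<close>
  define N where "N = (2 * E + 1) * (d * d')"
  have mono: "Q ^ (2 * N) * (f ^ i * h ^ j) \<in> ?W (2 * N * E)" if "i \<le> N" "j \<le> N" for i j
  proof -
    have "(Q * f) ^ i * ((Q * h) ^ j * (Q ^ l * 1)) = Q ^ (i + (j + l)) * (f ^ i * h ^ j)" for l
      by (simp add: power_mult_distrib power_add mult_ac)
    note this[of "2 * N - i - j"]
    moreover have "i + (j + (2 * N - i - j)) = 2 * N" using that by simp
    moreover have "i * E + (j * E + (2 * N - i - j) * E) = 2 * N * E"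
      using that by (metis (no_types) add_mult_distrib \<open>i + (j + (2 * N - i - j)) = 2 * N\<close>)
    ultimately show ?thesis using pow[of i j "2 * N - i - j"] by simp
  qed
  let ?P = "{..N} \<times> {..N}"
  define \<Phi> where "\<Phi> = (\<lambda>c :: nat \<times> nat \<Rightarrow> 'k. \<Sum>x\<in>?P. e (c x) * (Q ^ (2 * N) * (f ^ fst x * h ^ snd x)))"
  have "\<Phi> ` (?P \<rightarrow>\<^sub>E UNIV) \<subseteq> ?W (2 * N * E)"
    unfolding \<Phi>_def layer_def using mono
    by (auto intro!: vs.span_sum vs.span_scale simp: layer_def)
  moreover
  let ?B = "(\<lambda>(r, m). y ^ r * m) ` ({..2 * N * E} \<times> M)"
  have finM: "finite M" and cM: "card M \<le> d * d'"
  proof -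
    show "finite M" unfolding M_def by auto
    have "card M \<le> card ({..<d} \<times> ((\<lambda>j. h ^ j) ` {..<d'}))" unfolding M_def by (rule card_image_le) simp
    also have "\<dots> \<le> d * d'" using card_image_le[of "{..<d'}" "\<lambda>j. h ^ j"] by (simp add: card_cartesian_product)
    finally show "card M \<le> d * d'" .
  qed
  have cB: "card ?B < (N + 1) * (N + 1)"
  proof -
    have "card ?B \<le> (2 * N * E + 1) * card M"
      using card_image_le[of "{..2 * N * E} \<times> M" "\<lambda>(r, m). y ^ r * m"] finM
      by (simp add: card_cartesian_product)
    also have "\<dots> \<le> (2 * N * E + 1) * (d * d')" using cM by (intro mult_le_mono) auto
    also have "\<dots> \<le> ((2 * E + 1) * (N + 1)) * (d * d')"
      by (intro mult_le_mono) (auto simp: algebra_simps)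
    also have "\<dots> = (N + 1) * N" by (simp only: N_def mult_ac)
    also have "\<dots> < (N + 1) * (N + 1)" by simp
    finally show ?thesis .
  qed
  have finW: "finite (?W (2 * N * E))" and "card (?W (2 * N * E)) \<le> CARD('k) ^ card ?B"
    unfolding layer_def using card_span_le[of ?B] finM by auto
  ultimately have "card (?W (2 * N * E)) < CARD('k) ^ ((N + 1) * (N + 1))"
    using cB one_less_CARD_field[where 'k = 'k] by (meson le_less_trans power_strict_increasing)
  also have "\<dots> = card (?P \<rightarrow>\<^sub>E (UNIV :: 'k set))" by (simp add: card_PiE card_cartesian_product)
  finally have "card (?W (2 * N * E)) < card (?P \<rightarrow>\<^sub>E (UNIV :: 'k set))" .
  with \<open>\<Phi> ` (?P \<rightarrow>\<^sub>E UNIV) \<subseteq> ?W (2 * N * E)\<close> have "\<not> inj_on \<Phi> (?P \<rightarrow>\<^sub>E UNIV)"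
    using finW card_inj_on_le by (metis not_le)
  then obtain c c' where cc: "c \<in> ?P \<rightarrow>\<^sub>E UNIV" "c' \<in> ?P \<rightarrow>\<^sub>E UNIV" "\<Phi> c = \<Phi> c'" "c \<noteq> c'"
    by (auto simp: inj_on_def)
  then obtain i j where ij: "i \<le> N" "j \<le> N" "c (i, j) - c' (i, j) \<noteq> 0"
    by (metis (no_types, lifting) PiE_ext SigmaE atMost_iff right_minus_eq)
  have "Q ^ (2 * N) * (\<Sum>x\<in>?P. e (c x - c' x) * (f ^ fst x * h ^ snd x)) = \<Phi> c - \<Phi> c'"
    by (simp add: \<Phi>_def sum_distrib_left sum_subtractf[symmetric] e_diff algebra_simps)
  then have "(\<Sum>x\<in>?P. e (c x - c' x) * (f ^ fst x * h ^ snd x)) = 0" using cc Q0 by simp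
  moreover have "(\<Sum>x\<in>?P. e (c x - c' x) * (f ^ fst x * h ^ snd x))
     = (\<Sum>i\<le>N. f ^ i * (\<Sum>j\<le>N. e (c (i, j) - c' (i, j)) * h ^ j))"
    by (simp add: sum.cartesian_product sum_distrib_left case_prod_beta mult_ac)
  ultimately show ?thesis
    using ij by (intro exI[of _ N] exI[of _ "\<lambda>i j. c (i, j) - c' (i, j)"]) auto
qed

text \<open>
  Order a relation between \<open>f\<close> and \<open>h\<close> by powers of \<open>f\<close> and cancel the lowest power that occurs: its
  coefficient is a nonzero polynomial in \<open>h\<close>, and all other terms are divisible by \<open>f\<close>.
\<close>
lemma relation_modulo:
  assumes alg: "\<And>h. algebraic_over (localize (generated_algebra e {y}) {0}) h" and f: "f \<noteq> 0"
  shows "\<exists>N c. (\<exists>j\<le>N. c j \<noteq> 0) \<and> (\<exists>g\<in>generated_algebra e {f, h}. (\<Sum>j\<le>N. e (c j) * h ^ j) = f * g)"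
proof -
  obtain N c where nz: "\<exists>i\<le>N. \<exists>j\<le>N. c i j \<noteq> 0"
    and rel: "(\<Sum>i\<le>N. f ^ i * (\<Sum>j\<le>N. e (c i j) * h ^ j)) = 0"
    using algebraically_dependent[OF alg, of f h] by blast
  define a where "a i = (\<Sum>j\<le>N. e (c i j) * h ^ j)" for i
  have a: "a i \<in> generated_algebra e {f, h}" for i
    unfolding a_def by (intro alg_sum generated_algebra.mult alg_power) (auto intro: generated_algebra.intros)
  define k where "k = (LEAST i. \<exists>j\<le>N. c i j \<noteq> 0)"
  have k: "\<exists>j\<le>N. c k j \<noteq> 0" 
    using LeastI_ex[of "\<lambda>i. \<exists>j\<le>N. c i j \<noteq> 0"] nz unfolding k_def by blast
  have kN: "k \<le> N" 
    using Least_le[of "\<lambda>i. \<exists>j\<le>N. c i j \<noteq> 0"] nz unfolding k_def by (meson le_trans)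
  have low: "a i = 0" if "i < k" for i
    using not_less_Least[of i "\<lambda>i. \<exists>j\<le>N. c i j \<noteq> 0"] that by (auto simp: a_def k_def intro!: sum.neutral)
  define g where "g = - (\<Sum>i\<in>{k<..N}. f ^ (i - k - 1) * a i)"
  have split: "{..N} = {..<k} \<union> ({k} \<union> {k<..N})" using kN by auto
  have "0 = (\<Sum>i\<le>N. f ^ i * a i)" using rel by (simp add: a_def)
  also have "\<dots> = (\<Sum>i<k. f ^ i * a i) + (f ^ k * a k + (\<Sum>i\<in>{k<..N}. f ^ i * a i))"
    unfolding split by (subst sum.union_disjoint; (auto)?)
  also have "(\<Sum>i<k. f ^ i * a i) = 0" using low by simp
  also have "(\<Sum>i\<in>{k<..N}. f ^ i * a i) = f ^ k * (f * (- g))"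
    unfolding g_def minus_minus sum_distrib_left
  proof (rule sum.cong)
    fix i assume "i \<in> {k<..N}"
    then have "i = k + (1 + (i - k - 1))" by simp
    then have "f ^ i = f ^ k * (f * f ^ (i - k - 1))" by (metis power_add power_one_right)
    then show "f ^ i * a i = f ^ k * (f * (f ^ (i - k - 1) * a i))" by (simp add: mult.assoc)
  qed simp
  finally have "f ^ k * (a k - f * g) = 0" by (simp add: right_diff_distrib)
  then have "a k - f * g = 0" using f by (metis mult_eq_0_iff power_not_zero)
  then have "a k = f * g" by simp
  moreover have "g \<in> generated_algebra e {f, h}"
    unfolding g_def using a
    by (intro alg_neg alg_sum generated_algebra.mult alg_power) (auto intro: generated_algebra.intros)
  ultimately show ?thesis using k by (auto simp: a_def)
qed

end

section \<open>Finiteness of residue rings\<close>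

context finite_constants
begin

lemma ideal_subspace:
  assumes "prime_ideal_in (generated_algebra e S) p"
  shows "vs.subspace p"
proof (rule vs.subspaceI)
  fix c x assume "x \<in> p"
  then show "e c * x \<in> p"
    using assms generated_algebra.const[of e c S] by (simp add: prime_ideal_in_def)
qed (use assms in \<open>auto simp: prime_ideal_in_def\<close>)

lemma subspace_set_plus:
  assumes "vs.subspace U" "vs.subspace W"
  shows "vs.subspace (U + W)"
proof -
  have "U + W = {x + y | x y. x \<in> U \<and> y \<in> W}" by (auto simp: set_plus_def)
  then show ?thesis using vs.subspace_sums[OF assms] by simp
qed

text \<open>
  Computations modulo \<open>p\<close> are carried out with the subspace \<open>vs.span B + p\<close>.
\<close>
lemma mult_span_modulo:
  assumes p: "prime_ideal_in (generated_algebra e S) p" and a: "a \<in> generated_algebra e S"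
    and B: "\<And>b. b \<in> B \<Longrightarrow> a * b \<in> vs.span C + p" and v: "v \<in> vs.span B + p"
  shows "a * v \<in> vs.span C + p"
proof -
  have sub: "vs.subspace (vs.span C + p)"
    by (intro subspace_set_plus vs.subspace_span ideal_subspace[OF p])
  obtain w \<pi> where w: "w \<in> vs.span B" "\<pi> \<in> p" "v = w + \<pi>" using v by (rule set_plus_elim)
  have "a * w \<in> vs.span C + p"
    using w(1)
  proof (induction rule: vs.span_induct_alt)
    case base
    then show ?case using vs.subspace_0[OF sub] by simp
  next
    case (step c b w)
    have "e c * (a * b) + a * w \<in> vs.span C + p"
      using step B by (intro vs.subspace_add[OF sub] vs.subspace_scale[OF sub]) auto
    then show ?case by (simp add: algebra_simps)
  qed
  moreover have "a * \<pi> \<in> p" using p a w by (simp add: prime_ideal_in_def)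
  then have "0 + a * \<pi> \<in> vs.span C + p" by (intro set_plus_intro vs.span_zero)
  ultimately have "a * w + (0 + a * \<pi>) \<in> vs.span C + p" by (rule vs.subspace_add[OF sub])
  then show ?thesis using w by (simp add: algebra_simps)
qed

text \<open>
  Any nontrivial relation modulo \<open>p\<close> can be solved for its highest power, because nonzero constants
  are invertible; the highest power is not the zeroth one, since \<open>1 \<notin> p\<close>.
\<close>
lemma power_span_modulo:
  assumes p: "prime_ideal_in (generated_algebra e S) p" and s: "s \<in> generated_algebra e S"
    and rel: "(\<Sum>j\<le>N. e (c j) * s ^ j) \<in> p" and nz: "j\<^sub>0 \<le> N" "c j\<^sub>0 \<noteq> 0"
  shows "\<exists>d>0. s ^ d \<in> vs.span ((\<lambda>i. s ^ i) ` {..<d}) + p"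
proof -
  note sub = ideal_subspace[OF p]
  define d where "d = Max {j. j \<le> N \<and> c j \<noteq> 0}"
  have fin: "finite {j. j \<le> N \<and> c j \<noteq> 0}" by simp
  have d: "d \<le> N" "c d \<noteq> 0"
    using Max_in[OF fin] nz unfolding d_def by blast+
  have top: "c j = 0" if "j \<le> N" "d < j" for j
  proof (rule ccontr)
    assume "c j \<noteq> 0"
    then have "j \<in> {j. j \<le> N \<and> c j \<noteq> 0}" using that by simp
    from Max_ge[OF fin this] show False using that by (simp add: d_def)
  qed
  have "(\<Sum>j\<le>N. e (c j) * s ^ j) = (\<Sum>j\<le>d. e (c j) * s ^ j)"
    using d top by (intro sum.mono_neutral_right) auto
  then have *: "(\<Sum>j<d. e (c j) * s ^ j) + e (c d) * s ^ d \<in> p"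
    using rel by (simp add: lessThan_Suc_atMost[symmetric])
  have inv: "e (inverse (c d)) * e (c d) = 1" using d by (simp add: e_mult[symmetric] e_1)
  let ?\<pi> = "e (inverse (c d)) * ((\<Sum>j<d. e (c j) * s ^ j) + e (c d) * s ^ d)"
  let ?w = "e (inverse (c d)) * (- (\<Sum>j<d. e (c j) * s ^ j))"
  have pi: "?\<pi> \<in> p" using vs.subspace_scale[OF sub *] .
  have "d > 0"
  proof (rule ccontr)
    assume "\<not> d > 0"
    then have "1 \<in> p" using pi inv by simp
    then show False using p by (simp add: prime_ideal_in_def)
  qed
  have "?w \<in> vs.span ((\<lambda>i. s ^ i) ` {..<d})"
    by (intro vs.span_scale vs.span_neg vs.span_sum vs.span_base) auto
  from set_plus_intro[OF this pi] have mem: "?w + ?\<pi> \<in> vs.span ((\<lambda>i. s ^ i) ` {..<d}) + p" .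
  have "?w + ?\<pi> = e (inverse (c d)) * (e (c d) * s ^ d)"
    by (simp only: distrib_left[symmetric]) simp
  also have "\<dots> = s ^ d" using inv by (simp add: mult.assoc[symmetric])
  finally have "s ^ d \<in> vs.span ((\<lambda>i. s ^ i) ` {..<d}) + p" using mem by (simp only:)
  with \<open>d > 0\<close> show ?thesis by blast
qed

text \<open>
  Modulo a nonzero element of \<open>p\<close> every \<open>s\<close> satisfies a polynomial equation over the constants, so
  modulo \<open>p\<close> its powers are combinations of the first few.  Adding the generators one at a time, this
  produces finitely many elements \<open>B\<close> whose span, modulo \<open>p\<close>, contains \<open>1\<close> and is stable under all
  generators, hence is the whole algebra.
\<close>
lemma finite_quotient:
  assumes p: "prime_ideal_in (generated_algebra e S) p" and S: "finite S"
    and alg: "\<And>h. algebraic_over (localize (generated_algebra e {y}) {0}) h"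
    and f: "f \<in> p" "f \<noteq> 0"
  shows "\<exists>V\<subseteq>generated_algebra e S. finite V \<and> (\<forall>a\<in>generated_algebra e S. \<exists>v\<in>V. a - v \<in> p)"
proof -
  let ?A = "generated_algebra e S"
  have pA: "p \<subseteq> ?A" "\<And>a b. a \<in> ?A \<Longrightarrow> b \<in> p \<Longrightarrow> a * b \<in> p" using p by (auto simp: prime_ideal_in_def)
  have pow: "\<exists>d>0. s ^ d \<in> vs.span ((\<lambda>i. s ^ i) ` {..<d}) + p" if s: "s \<in> ?A" for s
  proof -
    obtain N c j g where *: "j \<le> N" "c j \<noteq> 0" "g \<in> generated_algebra e {f, s}"
      "(\<Sum>j\<le>N. e (c j) * s ^ j) = f * g"
      using relation_modulo[OF alg f(2), of s] by blast
    have "generated_algebra e {f, s} \<subseteq> ?A"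
      using s f pA by (intro alg_subset) (auto intro: generated_algebra.intros)
    then have "f * g \<in> p" using pA(2)[of g f] f(1) *(3) by (metis mult.commute subsetD)
    then show ?thesis using power_span_modulo[OF p s, where N = N and c = c and j\<^sub>0 = j] * by metis
  qed
  have "\<exists>B. finite B \<and> B \<subseteq> ?A \<and> 1 \<in> vs.span B \<and> (\<forall>t\<in>T. \<forall>b\<in>B. t * b \<in> vs.span B + p)"
    if "finite T" "T \<subseteq> ?A" for T
    using that
  proof (induction T)
    case empty
    then show ?case using alg_1 vs.span_base[of 1 "{1}"] by (intro exI[of _ "{1}"]) auto
  next
    case (insert s T)
    then obtain B where B: "finite B" "B \<subseteq> ?A" "1 \<in> vs.span B" "\<forall>t\<in>T. \<forall>b\<in>B. t * b \<in> vs.span B + p"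
      by auto
    have s: "s \<in> ?A" using insert by simp
    obtain d where d: "d > 0" "s ^ d \<in> vs.span ((\<lambda>i. s ^ i) ` {..<d}) + p" using pow[OF s] by blast
    define C where "C = (\<lambda>(b, j). b * s ^ j) ` (B \<times> {..<d})"
    have C: "b * s ^ j \<in> vs.span C + p" if "b \<in> B" "j < d" for b j
    proof -
      have "b * s ^ j + 0 \<in> vs.span C + p"
        using that p by (intro set_plus_intro vs.span_base) (auto simp: C_def prime_ideal_in_def)
      then show ?thesis by simp
    qed
    have "t * c \<in> vs.span C + p" if tc: "t \<in> insert s T" "c \<in> C" for t c
    proof -
      obtain b j where b: "b \<in> B" "j < d" "c = b * s ^ j" using tc by (auto simp: C_def)
      have bA: "b \<in> ?A" using b B by auto
      show ?thesis
      proof (cases "t = s")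
        case False
        have "s ^ j * (t * b) \<in> vs.span C + p"
        proof (rule mult_span_modulo[OF p alg_power[OF s], where B = B])
          show "t * b \<in> vs.span B + p" using False tc b B by auto
          show "s ^ j * b \<in> vs.span C + p" if "b \<in> B" for b
            using C[OF that b(2)] by (simp add: mult.commute)
        qed
        then show ?thesis using b by (simp add: mult_ac)
      next
        case True
        show ?thesis
        proof (cases "Suc j < d")
          case True
          then show ?thesis using C[OF b(1) True] \<open>t = s\<close> b by (simp add: mult_ac)
        next
          case False
          then have "d = Suc j" using b by simp
          moreover have "b * s ^ d \<in> vs.span C + p"
            by (rule mult_span_modulo[OF p bA _ d(2)]) (use C b in auto)
          ultimately show ?thesis using \<open>t = s\<close> b by (simp add: mult_ac)
        qed
      qed
    qed
    moreover have "B \<subseteq> C" using d by (force simp: C_def)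
    then have "1 \<in> vs.span C" using B vs.span_mono by blast
    moreover have "finite C" "C \<subseteq> ?A"
      using B s by (auto simp: C_def intro!: generated_algebra.mult alg_power)
    ultimately show ?case by blast
  qed
  from this[OF S] obtain B where B: "finite B" "B \<subseteq> ?A" "1 \<in> vs.span B"
    "\<forall>t\<in>S. \<forall>b\<in>B. t * b \<in> vs.span B + p" by (auto intro: generated_algebra.gen)
  let ?M = "vs.span B + p"
  have sub: "vs.subspace ?M" by (intro subspace_set_plus vs.subspace_span ideal_subspace[OF p])
  have "?A \<subseteq> {a. \<forall>v\<in>?M. a * v \<in> ?M}"
  proof (rule alg_subset)
    show "S \<subseteq> {a. \<forall>v\<in>?M. a * v \<in> ?M}"
    proof (intro subsetI CollectI ballI)
      fix s v assume s: "s \<in> S" and v: "v \<in> ?M"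
      show "s * v \<in> ?M"
        by (rule mult_span_modulo[OF p generated_algebra.gen[OF s] _ v]) (use B(4) s in blast)
    qed
    show "range e \<subseteq> {a. \<forall>v\<in>?M. a * v \<in> ?M}" using vs.subspace_scale[OF sub] by auto
    fix a b assume a: "a \<in> {a. \<forall>v\<in>?M. a * v \<in> ?M}" and b: "b \<in> {a. \<forall>v\<in>?M. a * v \<in> ?M}"
    show "a + b \<in> {a. \<forall>v\<in>?M. a * v \<in> ?M}"
    proof (intro CollectI ballI)
      fix v assume "v \<in> ?M"
      then have "a * v + b * v \<in> ?M" using a b by (intro vs.subspace_add[OF sub]) blast+
      then show "(a + b) * v \<in> ?M" by (simp only: distrib_right)
    qed
    show "a * b \<in> {a. \<forall>v\<in>?M. a * v \<in> ?M}"
    proof (intro CollectI ballI)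
      fix v assume "v \<in> ?M"
      then have "a * (b * v) \<in> ?M" using a b by blast
      then show "a * b * v \<in> ?M" by (simp only: mult.assoc)
    qed
  qed
  moreover have "1 + 0 \<in> ?M"
    using B p by (intro set_plus_intro) (auto simp: prime_ideal_in_def)
  ultimately have AM: "a \<in> ?M" if "a \<in> ?A" for a using that by force
  have "\<exists>v\<in>vs.span B. a - v \<in> p" if "a \<in> ?A" for a
    using AM[OF that] by (auto elim!: set_plus_elim intro!: bexI)
  moreover have "vs.span B \<subseteq> ?A" by (rule vs.span_minimal[OF B(2) alg_subspace])
  ultimately show ?thesis using card_span_le(1)[OF B(1)] by blast
qed

end

section \<open>Local rings of a smooth curve\<close>

locale smooth_curve =
  fixes X :: "('k::{field,finite}, 'f::field) curve"
  assumes smooth_projective_curve: "smooth_projective_curve X"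

sublocale smooth_curve \<subseteq> finite_constants "emb X"
  using smooth_projective_curve
  by unfold_locales (auto simp: smooth_projective_curve_def projective_integral_def)

context smooth_curve
begin

lemma algebraic_parameter:
  "\<exists>y. \<forall>h. algebraic_over (localize (generated_algebra (emb X) {y}) {0}) h"
  using smooth_projective_curve by (auto simp: smooth_projective_curve_def one_dimensional_def)

lemma closed_point_localization:
  assumes "P \<in> closed_points X"
  obtains S p where "finite S" "generated_algebra (emb X) S \<in> charts X"
    "prime_ideal_in (generated_algebra (emb X) S) p" "P = localize (generated_algebra (emb X) S) p"
proof -
  obtain A p where A: "A \<in> charts X" "prime_ideal_in A p" "P = localize A p"
    using assms by (auto simp: closed_points_def points_def)
  then obtain x where "A = generated_algebra (emb X) {y / x | y. y \<in> set (coords X)}"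
    by (auto simp: charts_def)
  moreover have "finite {y / x | y. y \<in> set (coords X)}"
    by (simp add: setcompr_eq_image)
  ultimately show thesis using that A by blast
qed

lemma chart_fraction_field: "A \<in> charts X \<Longrightarrow> localize A {0} = UNIV"
  using smooth_projective_curve by (auto simp: smooth_projective_curve_def projective_integral_def)

context
  fixes A p P S
  assumes A: "A = generated_algebra (emb X) S" and p: "prime_ideal_in A p" and P: "P = localize A p"
begin

lemma algebra_closed: "a \<in> A \<Longrightarrow> b \<in> A \<Longrightarrow> a + b \<in> A" "a \<in> A \<Longrightarrow> b \<in> A \<Longrightarrow> a * b \<in> A"
    "a \<in> A \<Longrightarrow> b \<in> A \<Longrightarrow> a - b \<in> A" "emb X c \<in> A" "1 \<in> A" "0 \<in> A"
  by (auto simp: A generated_algebra.intros alg_diff alg_1 alg_0)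

lemma prime_ideal_closed: "a \<in> p \<Longrightarrow> b \<in> p \<Longrightarrow> a + b \<in> p" "a \<in> A \<Longrightarrow> b \<in> p \<Longrightarrow> a * b \<in> p"
    "a \<in> A \<Longrightarrow> b \<in> A \<Longrightarrow> a * b \<in> p \<Longrightarrow> a \<in> p \<or> b \<in> p" "a \<in> p \<Longrightarrow> a \<in> A" "1 \<notin> p" "0 \<in> p"
  using p by (auto simp: prime_ideal_in_def)

lemma in_localization_iff: "x \<in> P \<longleftrightarrow> (\<exists>a\<in>A. \<exists>s\<in>A. s \<notin> p \<and> x = a / s)"
  by (auto simp: P localize_def)

text \<open>
  The non-units of the localization are the fractions with numerator in \<open>p\<close>.  In particular they
  form an ideal, which the definition as a complement of the units leaves open.
\<close>
lemma in_max_ideal_iff: "x \<in> max_ideal P \<longleftrightarrow> (\<exists>a\<in>p. \<exists>s\<in>A. s \<notin> p \<and> x = a / s)"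
proof
  assume x: "x \<in> max_ideal P"
  then obtain a s where as: "a \<in> A" "s \<in> A" "s \<notin> p" "x = a / s"
    by (auto simp: max_ideal_def in_localization_iff)
  have "a \<in> p"
  proof (rule ccontr)
    assume "a \<notin> p"
    then have "s / a \<in> P" "a \<noteq> 0" "s \<noteq> 0" using as prime_ideal_closed by (auto simp: in_localization_iff)
    then have "x * (s / a) = 1" "s / a \<in> P" using as by auto
    then show False using x by (auto simp: max_ideal_def units_of_ring_def)
  qed
  with as show "\<exists>a\<in>p. \<exists>s\<in>A. s \<notin> p \<and> x = a / s" by blast
next
  assume "\<exists>a\<in>p. \<exists>s\<in>A. s \<notin> p \<and> x = a / s"
  then obtain a s where as: "a \<in> p" "s \<in> A" "s \<notin> p" "x = a / s" by blast
  have "x * y \<noteq> 1" if y: "y \<in> P" for y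
  proof
    assume xy: "x * y = 1"
    obtain b t where bt: "b \<in> A" "t \<in> A" "t \<notin> p" "y = b / t" using y by (auto simp: in_localization_iff)
    have "s \<noteq> 0" "t \<noteq> 0" using as bt prime_ideal_closed by auto
    then have "b * a = s * t" using xy as bt by (simp add: field_simps)
    then have "s * t \<in> p" using prime_ideal_closed(2)[OF bt(1) as(1)] by simp
    then show False using prime_ideal_closed(3) as bt by blast
  qed
  moreover have "x \<in> P" using as prime_ideal_closed(4) by (auto simp: in_localization_iff)
  ultimately show "x \<in> max_ideal P" by (auto simp: max_ideal_def units_of_ring_def)
qed

lemma localization_add: "x \<in> P \<Longrightarrow> y \<in> P \<Longrightarrow> x + y \<in> P"
proof -
  assume "x \<in> P" "y \<in> P"
  then obtain a s b t where *: "a \<in> A" "s \<in> A" "s \<notin> p" "x = a / s" "b \<in> A" "t \<in> A" "t \<notin> p" "y = b / t"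
    by (auto simp: in_localization_iff)
  moreover from * have "s * t \<notin> p" using prime_ideal_closed(3) by blast
  moreover from * have "s \<noteq> 0" "t \<noteq> 0" using prime_ideal_closed(6) by auto
  ultimately have "x + y = (a * t + b * s) / (s * t)" by (simp add: field_simps)
  with * \<open>s * t \<notin> p\<close> show ?thesis unfolding in_localization_iff using algebra_closed by blast
qed

lemma localization_mult: "x \<in> P \<Longrightarrow> y \<in> P \<Longrightarrow> x * y \<in> P"
proof -
  assume "x \<in> P" "y \<in> P"
  then obtain a s b t where *: "a \<in> A" "s \<in> A" "s \<notin> p" "x = a / s" "b \<in> A" "t \<in> A" "t \<notin> p" "y = b / t"
    by (auto simp: in_localization_iff)
  then have "s * t \<notin> p" using prime_ideal_closed(3) by blast
  moreover have "x * y = (a * b) / (s * t)" using * by simp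
  ultimately show ?thesis using * unfolding in_localization_iff using algebra_closed by blast
qed

lemma localization_base: "a \<in> A \<Longrightarrow> a \<in> P"
  unfolding in_localization_iff using algebra_closed(5) prime_ideal_closed(5) by (metis div_by_1)

lemma prime_ideal_nonzero: "P \<noteq> UNIV \<Longrightarrow> localize A {0} = UNIV \<Longrightarrow> \<exists>f\<in>p. f \<noteq> 0"
proof (rule ccontr)
  assume "P \<noteq> UNIV" "localize A {0} = UNIV" "\<not> (\<exists>f\<in>p. f \<noteq> 0)"
  moreover from this have "p = {0}" using prime_ideal_closed(6) by auto
  ultimately show False using P by simp
qed

text \<open>
  The class of \<open>a / s\<close> depends only on the classes of \<open>a\<close> and \<open>s\<close> modulo \<open>p\<close>.
\<close>
lemma finite_residue_field:
  assumes S: "finite S" and f: "f \<in> p" "f \<noteq> 0"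
  shows "\<exists>T\<subseteq>P. finite T \<and> (\<forall>x\<in>P. \<exists>\<tau>\<in>T. x - \<tau> \<in> max_ideal P)"
proof -
  obtain y where y: "\<And>h. algebraic_over (localize (generated_algebra (emb X) {y}) {0}) h"
    using algebraic_parameter by blast
  obtain V where V: "V \<subseteq> A" "finite V" "\<And>a. a \<in> A \<Longrightarrow> \<exists>v\<in>V. a - v \<in> p"
    using finite_quotient[OF p[unfolded A] S y f] unfolding A by metis
  have minus: "a - b \<in> p" if "a \<in> p" "b \<in> p" for a b
    using vs.subspace_diff[OF ideal_subspace[OF p[unfolded A]]] that by blast
  define T where "T = (\<lambda>(v, w). v / w) ` (V \<times> (V - p))"
  have "T \<subseteq> P" using V(1) by (force simp: T_def in_localization_iff)
  moreover have "finite T" using V(2) by (simp add: T_def)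
  moreover have "\<exists>\<tau>\<in>T. x - \<tau> \<in> max_ideal P" if "x \<in> P" for x
  proof -
    obtain a s where as: "a \<in> A" "s \<in> A" "s \<notin> p" "x = a / s"
      using \<open>x \<in> P\<close> by (auto simp: in_localization_iff)
    obtain v w where v: "v \<in> V" "a - v \<in> p" and w: "w \<in> V" "s - w \<in> p" using V(3) as by metis
    have wp: "w \<notin> p" using w prime_ideal_closed(1)[of "s - w" w] as by auto
    have "w * (a - v) - v * (s - w) \<in> p" using V(1) v w by (intro minus[of "w * (a - v)"] prime_ideal_closed(2)) auto
    moreover have "s * w \<notin> p" using prime_ideal_closed(3)[of s w] as w wp V(1) by blast
    moreover have "s \<noteq> 0" "w \<noteq> 0" using as wp prime_ideal_closed(6) by auto
    then have "x - v / w = (w * (a - v) - v * (s - w)) / (s * w)" using as by (simp add: field_simps)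
    moreover have "s * w \<in> A" using as w V(1) algebra_closed(2) by blast
    ultimately have "x - v / w \<in> max_ideal P" unfolding in_max_ideal_iff by blast
    moreover have "v / w \<in> T" using v w wp by (force simp: T_def)
    ultimately show ?thesis by blast
  qed
  ultimately show ?thesis by blast
qed

end

text \<open>
  From here on a closed point is used only through these properties, without reference to the chart
  in which it lies.
\<close>

lemma
  assumes "P \<in> closed_points X"
  shows point_add: "x \<in> P \<Longrightarrow> y \<in> P \<Longrightarrow> x + y \<in> P" and point_mult: "x \<in> P \<Longrightarrow> y \<in> P \<Longrightarrow> x * y \<in> P"
    and point_const: "emb X c \<in> P"
    and point_fraction: "\<exists>a\<in>P. \<exists>b\<in>P. b \<noteq> 0 \<and> h = a / b"
    and point_residues: "\<exists>T\<subseteq>P. finite T \<and> (\<forall>x\<in>P. \<exists>\<tau>\<in>T. x - \<tau> \<in> max_ideal P)"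
proof -
  obtain S p where S: "finite S" "generated_algebra (emb X) S \<in> charts X"
    and p: "prime_ideal_in (generated_algebra (emb X) S) p" and P: "P = localize (generated_algebra (emb X) S) p"
    using closed_point_localization[OF assms] by metis
  note loc = refl p P
  show "x \<in> P \<Longrightarrow> y \<in> P \<Longrightarrow> x + y \<in> P" by (rule localization_add[OF loc])
  show "x \<in> P \<Longrightarrow> y \<in> P \<Longrightarrow> x * y \<in> P" by (rule localization_mult[OF loc])
  show "emb X c \<in> P" by (rule localization_base[OF loc generated_algebra.const])
  have "h \<in> localize (generated_algebra (emb X) S) {0}" using chart_fraction_field[OF S(2)] by simp
  then show "\<exists>a\<in>P. \<exists>b\<in>P. b \<noteq> 0 \<and> h = a / b"
    using localization_base[OF loc] unfolding localize_def by blast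
  have "\<exists>f\<in>p. f \<noteq> 0"
    using assms chart_fraction_field[OF S(2)] by (intro prime_ideal_nonzero[OF loc]) (auto simp: closed_points_def)
  then show "\<exists>T\<subseteq>P. finite T \<and> (\<forall>x\<in>P. \<exists>\<tau>\<in>T. x - \<tau> \<in> max_ideal P)"
    using finite_residue_field[OF loc S(1)] by blast
qed

end

section \<open>Orders of vanishing\<close>

context smooth_curve
begin

lemma exists_uniformizer: "P \<in> closed_points X \<Longrightarrow> \<exists>t. uniformizer P t"
  using smooth_projective_curve by (auto simp: smooth_projective_curve_def smooth_def)

text \<open>
  The filtration of the function field by the order at \<open>P\<close>.  In contrast to \<open>ord_at P\<close> itself, whose value
  at \<open>0\<close> is meaningless, its members are subspaces.
\<close>
definition vanishing :: "'f set \<Rightarrow> int \<Rightarrow> 'f set" where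
  "vanishing P n = {h. h = 0 \<or> n \<le> ord_at P h}"

lemma RR_space_eq: "RR_space X G = {h. \<forall>P\<in>closed_points X. h \<in> vanishing P (- Poly_Mapping.lookup G P)}"
  by (auto simp: RR_space_def vanishing_def)

context
  fixes P assumes P: "P \<in> closed_points X"
begin

lemma point_0: "0 \<in> P" and point_1: "1 \<in> P"
  using point_const[OF P, of 0] point_const[OF P, of 1] by (simp_all add: e_1)

lemma point_power: "x \<in> P \<Longrightarrow> x ^ n \<in> P"
  by (induction n) (auto intro: point_1 point_mult[OF P])

lemma point_subspace: "vs.subspace P"
  by (intro vs.subspaceI) (auto intro: point_0 point_add[OF P] point_mult[OF P] point_const[OF P])

lemma units_iff: "u \<in> units_of_ring P \<longleftrightarrow> u \<noteq> 0 \<and> u \<in> P \<and> inverse u \<in> P"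
proof
  assume "u \<in> units_of_ring P"
  then obtain v where "u \<in> P" "v \<in> P" "u * v = 1" by (auto simp: units_of_ring_def)
  moreover from this have "v = inverse u" by (metis inverse_unique)
  ultimately show "u \<noteq> 0 \<and> u \<in> P \<and> inverse u \<in> P" by auto
next
  assume "u \<noteq> 0 \<and> u \<in> P \<and> inverse u \<in> P"
  then show "u \<in> units_of_ring P" unfolding units_of_ring_def by (intro CollectI conjI bexI[of _ "inverse u"]) auto
qed

lemma const_unit: "c \<noteq> 0 \<Longrightarrow> emb X c \<in> units_of_ring P"
  unfolding units_iff using point_const[OF P, of c] point_const[OF P, of "inverse c"]
  by (metis e_1 e_eq_0_iff e_mult inverse_unique right_inverse)

lemma unit_mult: "u \<in> units_of_ring P \<Longrightarrow> v \<in> units_of_ring P \<Longrightarrow> u * v \<in> units_of_ring P"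
  by (auto simp: units_iff point_mult[OF P])

lemma unit_inverse: "u \<in> units_of_ring P \<Longrightarrow> inverse u \<in> units_of_ring P"
  by (auto simp: units_iff)

lemma unit_powi: "u \<in> units_of_ring P \<Longrightarrow> u powi n \<in> units_of_ring P"
  using point_power[of u] point_power[of "inverse u"]
  unfolding units_iff by (auto simp: power_int_def power_inverse)

context
  fixes t assumes t: "uniformizer P t"
begin

lemma in_max_ideal: "x \<in> max_ideal P \<longleftrightarrow> (\<exists>a\<in>P. x = t * a)"
  using t by (auto simp: uniformizer_def)

lemma uniformizer_in_max_ideal: "t \<in> max_ideal P"
  unfolding in_max_ideal using point_1 by force

lemma uniformizer_in_point: "t \<in> P" and uniformizer_not_unit: "t \<notin> units_of_ring P"
  using uniformizer_in_max_ideal by (auto simp: max_ideal_def)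

lemma uniformizer_nonzero: "t \<noteq> 0"
proof
  assume "t = 0"
  then have "max_ideal P \<subseteq> {0}" by (auto simp: in_max_ideal)
  then have inv: "inverse b \<in> P" if "b \<in> P" "b \<noteq> 0" for b
    using that units_iff by (auto simp: max_ideal_def)
  have "h \<in> P" for h
  proof -
    obtain a b where "a \<in> P" "b \<in> P" "b \<noteq> 0" "h = a / b" using point_fraction[OF P] by blast
    then show ?thesis using point_mult[OF P] inv by (simp add: divide_inverse)
  qed
  then show False using P by (auto simp: closed_points_def)
qed

lemma inverse_uniformizer_notin: "inverse t \<notin> P"
  using uniformizer_not_unit uniformizer_in_point uniformizer_nonzero units_iff by blast

text \<open>
  This takes the place of the Krull intersection theorem.  Modulo \<open>h\<close>, the uniformizer \<open>t\<close> satisfies a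
  nontrivial polynomial equation over the constants.  If \<open>t ^ m\<close> is the lowest power occurring in it and
  \<open>h\<close> were divisible by \<open>t ^ (m + 1)\<close>, then dividing by \<open>t ^ m\<close> would show that \<open>t\<close> divides a nonzero
  constant.
\<close>
lemma divisibility_by_uniformizer_bounded:
  assumes h: "h \<noteq> 0" "h \<in> P"
  shows "\<exists>n. \<not> (\<exists>a\<in>P. h = t ^ n * a)"
proof (rule ccontr)
  assume "\<not> ?thesis"
  then have div: "\<exists>a\<in>P. h = t ^ n * a" for n by blast
  obtain y where y: "\<And>h. algebraic_over (localize (generated_algebra (emb X) {y}) {0}) h"
    using algebraic_parameter by blast
  obtain N c g where nz: "\<exists>j\<le>N. c j \<noteq> 0" and g: "g \<in> generated_algebra (emb X) {h, t}"
    and rel: "(\<Sum>j\<le>N. emb X (c j) * t ^ j) = h * g"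
    using relation_modulo[OF y h(1), of t] by blast
  have "generated_algebra (emb X) {h, t} \<subseteq> P"
    using h uniformizer_in_point
    by (intro alg_subset) (auto intro: point_const[OF P] point_add[OF P] point_mult[OF P])
  with g have gP: "g \<in> P" by blast
  define m where "m = (LEAST j. j \<le> N \<and> c j \<noteq> 0)"
  have m: "m \<le> N" "c m \<noteq> 0"
    using LeastI_ex[of "\<lambda>j. j \<le> N \<and> c j \<noteq> 0"] nz by (auto simp: m_def)
  have low: "c j = 0" if "j < m" for j
    using not_less_Least[of j "\<lambda>j. j \<le> N \<and> c j \<noteq> 0"] that m by (auto simp: m_def)
  obtain w where w: "w \<in> P" "h = t ^ Suc m * w" using div by blast
  let ?r = "\<Sum>j\<in>{m<..N}. emb X (c j) * t ^ (j - m - 1)"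
  have split: "{..N} = {..<m} \<union> ({m} \<union> {m<..N})" using m by auto
  have "t ^ m * (t * (w * g)) = (\<Sum>j\<le>N. emb X (c j) * t ^ j)"
    using rel w by (simp add: mult_ac)
  also have "\<dots> = (\<Sum>j<m. emb X (c j) * t ^ j) +
      (emb X (c m) * t ^ m + (\<Sum>j\<in>{m<..N}. emb X (c j) * t ^ j))"
    unfolding split by (subst sum.union_disjoint; (auto)?)
  also have "(\<Sum>j<m. emb X (c j) * t ^ j) = 0" using low by simp
  also have "(\<Sum>j\<in>{m<..N}. emb X (c j) * t ^ j) = t ^ m * (t * ?r)"
    unfolding sum_distrib_left
  proof (rule sum.cong)
    fix j assume "j \<in> {m<..N}"
    then have "j = m + (1 + (j - m - 1))" by simp
    then have "t ^ j = t ^ m * (t * t ^ (j - m - 1))" by (metis power_add power_one_right)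
    then show "emb X (c j) * t ^ j = t ^ m * (t * (emb X (c j) * t ^ (j - m - 1)))"
      by (simp add: mult_ac)
  qed simp
  finally have "t ^ m * (t * (w * g)) = t ^ m * (emb X (c m) + t * ?r)"
    by (simp add: distrib_left mult.commute)
  then have "t * (w * g) = emb X (c m) + t * ?r"
    using mult_left_cancel[OF power_not_zero[OF uniformizer_nonzero]] by blast
  then have "emb X (c m) = t * (w * g - ?r)" by (simp add: right_diff_distrib)
  moreover have "w * g - ?r \<in> P"
    by (intro vs.subspace_diff[OF point_subspace] vs.subspace_sum[OF point_subspace] point_mult[OF P] w gP
        point_const[OF P] point_power uniformizer_in_point)
  ultimately have "emb X (c m) \<in> max_ideal P" by (auto simp: in_max_ideal)
  then show False using const_unit[OF m(2)] by (simp add: max_ideal_def)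
qed

text \<open>
  Divide by the largest power of \<open>t\<close> that divides \<open>h\<close>; the cofactor is not divisible by \<open>t\<close>, hence a unit.
\<close>
lemma factorization_in_point:
  assumes "h \<in> P" "h \<noteq> 0"
  shows "\<exists>u\<in>units_of_ring P. \<exists>n. h = u * t ^ n"
proof -
  let ?Q = "\<lambda>n. \<not> (\<exists>a\<in>P. h = t ^ n * a)"
  have Q: "?Q (LEAST n. ?Q n)"
    using divisibility_by_uniformizer_bounded[OF assms(2,1)] by (rule LeastI_ex)
  have "(LEAST n. ?Q n) \<noteq> 0"
  proof
    assume "(LEAST n. ?Q n) = 0"
    then have "?Q 0" using Q by simp
    then show False using assms by simp
  qed
  then obtain n where n: "(LEAST n. ?Q n) = Suc n" by (metis not0_implies_Suc)
  then have "\<not> ?Q n" using not_less_Least[of n ?Q] by simp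
  then obtain a where a: "a \<in> P" "h = t ^ n * a" by blast
  have "a \<notin> max_ideal P"
  proof
    assume "a \<in> max_ideal P"
    then obtain b where "b \<in> P" "a = t * b" by (auto simp: in_max_ideal)
    then have "h = t ^ Suc n * b" using a by (simp add: mult_ac)
    then show False using Q \<open>b \<in> P\<close> n by auto
  qed
  then have "a \<in> units_of_ring P" using a by (simp add: max_ideal_def)
  then show ?thesis using a by (auto simp: mult.commute)
qed

lemma factorization:
  assumes "h \<noteq> 0"
  shows "\<exists>u\<in>units_of_ring P. \<exists>n. h = u * t powi n"
proof -
  obtain a b where ab: "a \<in> P" "b \<in> P" "b \<noteq> 0" "h = a / b" using point_fraction[OF P] by blast
  then have "a \<noteq> 0" using assms by auto
  obtain u m where u: "u \<in> units_of_ring P" "a = u * t ^ m"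
    using factorization_in_point[OF ab(1) \<open>a \<noteq> 0\<close>] by blast
  obtain v n where v: "v \<in> units_of_ring P" "b = v * t ^ n"
    using factorization_in_point[OF ab(2,3)] by blast
  have "h = (u * inverse v) * t powi (int m - int n)"
    using uniformizer_nonzero u v ab by (simp add: power_int_diff divide_inverse)
  then show ?thesis using unit_mult[OF u(1) unit_inverse[OF v(1)]] by blast
qed

lemma unit_times_powi_in_point_iff:
  assumes u: "u \<in> units_of_ring P"
  shows "u * t powi n \<in> P \<longleftrightarrow> 0 \<le> n"
proof
  assume "0 \<le> n"
  then show "u * t powi n \<in> P"
    using u by (auto simp: power_int_def units_iff intro: point_mult[OF P] point_power uniformizer_in_point)
next
  assume *: "u * t powi n \<in> P"
  show "0 \<le> n"
  proof (rule ccontr)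
    assume "\<not> 0 \<le> n"
    then have "inverse t = inverse u * (t ^ nat (- n - 1) * (u * t powi n))"
      using u uniformizer_nonzero
      by (simp add: units_iff field_simps power_int_def flip: power_Suc) (simp add: Suc_nat_eq_nat_zadd1)
    moreover have "inverse u * (t ^ nat (- n - 1) * (u * t powi n)) \<in> P"
      using u by (intro point_mult[OF P _ point_mult[OF P _ *]] point_power uniformizer_in_point)
        (auto simp: units_iff)
    ultimately show False using inverse_uniformizer_notin by simp
  qed
qed

end

text \<open>
  The exponent is independent of the uniformizer, because two uniformizers divide each other and so
  differ by a unit.  This is what makes the definite description in \<open>ord_at\<close> meaningful.
\<close>
lemma ord_at_unit_times_powi:
  assumes t: "uniformizer P t" and u: "u \<in> units_of_ring P"
  shows "ord_at P (u * t powi n) = n"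
  unfolding ord_at_def
proof (rule the_equality)
  show "\<exists>t' u'. uniformizer P t' \<and> u' \<in> units_of_ring P \<and> u * t powi n = u' * t' powi n"
    using assms by blast
next
  fix m assume "\<exists>t' u'. uniformizer P t' \<and> u' \<in> units_of_ring P \<and> u * t powi n = u' * t' powi m"
  then obtain t' u' where t': "uniformizer P t'" "u' \<in> units_of_ring P" "u * t powi n = u' * t' powi m" by blast
  obtain v where v: "v \<in> P" "t' = t * v"
    using uniformizer_in_max_ideal[OF t'(1)] in_max_ideal[OF t] by blast
  obtain w where w: "w \<in> P" "t = t' * w"
    using uniformizer_in_max_ideal[OF t] in_max_ideal[OF t'(1)] by blast
  have t0: "t \<noteq> 0" using uniformizer_nonzero[OF t] .
  have "t * (v * w) = t * 1" using v(2) w(2) by (metis mult.assoc mult_1_right)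
  then have "v * w = 1" using mult_left_cancel[OF t0] by blast
  then have vU: "v \<in> units_of_ring P" using v w by (auto simp: units_of_ring_def)
  have eq: "u * t powi n = (u' * v powi m) * t powi m"
    using t'(3) v by (simp add: power_int_mult_distrib mult_ac)
  have u'U: "u' * v powi m \<in> units_of_ring P" using unit_mult[OF t'(2) unit_powi[OF vU]] .
  have "u * t powi (n - m) = u' * v powi m" "u' * v powi m * t powi (m - n) = u"
    using eq t0 by (simp_all add: power_int_diff field_simps)
  then have "u * t powi (n - m) \<in> P" "u' * v powi m * t powi (m - n) \<in> P"
    using u u'U by (auto simp: units_iff)
  then have "n - m \<ge> 0" "m - n \<ge> 0"
    using unit_times_powi_in_point_iff[OF t] u u'U by auto
  then show "m = n" by simp
qed

lemma in_vanishing_iff: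
  assumes t: "uniformizer P t"
  shows "h \<in> vanishing P n \<longleftrightarrow> h * t powi (- n) \<in> P"
proof (cases "h = 0")
  case True
  then show ?thesis by (simp add: vanishing_def point_0)
next
  case False
  obtain u m where u: "u \<in> units_of_ring P" "h = u * t powi m" using factorization[OF t False] by blast
  have "h * t powi (- n) = u * t powi (m - n)"
    using u uniformizer_nonzero[OF t] by (simp add: power_int_diff power_int_minus divide_inverse)
  then have "h * t powi (- n) \<in> P \<longleftrightarrow> n \<le> m"
    using unit_times_powi_in_point_iff[OF t u(1)] by simp
  moreover have "ord_at P h = m" using ord_at_unit_times_powi[OF t u(1)] u(2) by simp
  ultimately show ?thesis using False by (simp add: vanishing_def)
qed

lemma vanishing_subspace: "vs.subspace (vanishing P n)"
proof -
  obtain t where t: "uniformizer P t" using exists_uniformizer[OF P] by blast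
  note sub = point_subspace
  show ?thesis
    by (intro vs.subspaceI)
       (auto simp: in_vanishing_iff[OF t] distrib_right mult.assoc
         intro: vs.subspace_0[OF sub] vs.subspace_add[OF sub] vs.subspace_scale[OF sub])
qed

lemma vanishing_0: "vanishing P 0 = P"
  using exists_uniformizer[OF P] in_vanishing_iff by auto

lemma vanishing_1: "vanishing P 1 = max_ideal P"
proof -
  obtain t where t: "uniformizer P t" using exists_uniformizer[OF P] by blast
  have "h = t * a \<longleftrightarrow> h * t powi (- 1) = a" for h a
    using uniformizer_nonzero[OF t] by (auto simp: power_int_minus field_simps)
  then have "h * t powi (- 1) \<in> P \<longleftrightarrow> (\<exists>a\<in>P. h = t * a)" for h by auto
  then show ?thesis using in_vanishing_iff[OF t] in_max_ideal[OF t] by auto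
qed

lemma vanishing_antimono: "m \<le> n \<Longrightarrow> vanishing P n \<subseteq> vanishing P m"
  by (auto simp: vanishing_def)

text \<open>
  Multiplication by a power of the uniformizer reduces this to the residue field \<open>P / max_ideal P\<close>.
\<close>
lemma vanishing_residues:
  "\<exists>T. finite T \<and> (\<forall>h\<in>vanishing P n. \<exists>\<tau>\<in>T. h - \<tau> \<in> vanishing P (n + 1))"
proof -
  obtain t where t: "uniformizer P t" using exists_uniformizer[OF P] by blast
  have t0: "t \<noteq> 0" by (rule uniformizer_nonzero[OF t])
  obtain T where T: "finite T" "\<And>x. x \<in> P \<Longrightarrow> \<exists>\<tau>\<in>T. x - \<tau> \<in> max_ideal P"
    using point_residues[OF P] by blast
  have "\<exists>\<tau>\<in>(\<lambda>\<tau>. \<tau> * t powi n) ` T. h - \<tau> \<in> vanishing P (n + 1)" if h: "h \<in> vanishing P n" for h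
  proof -
    obtain \<tau> where \<tau>: "\<tau> \<in> T" "h * t powi (- n) - \<tau> \<in> max_ideal P"
      using T(2) h in_vanishing_iff[OF t] by blast
    then have "(h * t powi (- n) - \<tau>) * t powi (- 1) \<in> P"
      using vanishing_1 in_vanishing_iff[OF t] by blast
    moreover have inv: "t powi n * t powi (- n) = 1" using t0 by (simp add: power_int_minus)
    have "t powi n * (t powi (- n) * z) = z" for z by (simp only: mult.assoc[symmetric] inv mult_1_left)
    moreover have "t powi (- (n + 1)) = t powi (- n) * t powi (- 1)"
      using t0 power_int_add[of t "- n" "- 1"] by simp
    ultimately have "(h - \<tau> * t powi n) * t powi (- (n + 1)) \<in> P"
      by (simp only: left_diff_distrib mult.assoc)
    then have "h - \<tau> * t powi n \<in> vanishing P (n + 1)" using in_vanishing_iff[OF t] by blast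
    then show ?thesis using \<tau> by blast
  qed
  then show ?thesis using T(1) by blast
qed

end

end

section \<open>Functions without poles\<close>

text \<open>
  By Zorn's lemma there is a maximal proper ideal containing \<open>I\<close>, and maximal ideals are prime.
\<close>
lemma (in finite_constants) proper_ideal_in_prime_ideal:
  fixes S defines "A \<equiv> generated_algebra e S"
  assumes I: "I \<subseteq> A" "0 \<in> I" "\<And>a b. a \<in> I \<Longrightarrow> b \<in> I \<Longrightarrow> a + b \<in> I"
    "\<And>a b. a \<in> A \<Longrightarrow> b \<in> I \<Longrightarrow> a * b \<in> I" "1 \<notin> I"
  shows "\<exists>p. prime_ideal_in A p \<and> I \<subseteq> p"
proof -
  define proper where "proper = {J. I \<subseteq> J \<and> J \<subseteq> A \<and> 1 \<notin> J \<and>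
    (\<forall>a\<in>J. \<forall>b\<in>J. a + b \<in> J) \<and> (\<forall>a\<in>A. \<forall>b\<in>J. a * b \<in> J)}"
  have "\<exists>M\<in>proper. \<forall>J\<in>proper. M \<subseteq> J \<longrightarrow> J = M"
  proof (rule subset_Zorn_nonempty)
    have "I \<in> proper" using I by (simp add: proper_def)
    then show "proper \<noteq> {}" by blast
    fix C assume C: "C \<noteq> {}" "subset.chain proper C"
    have sub: "J \<in> proper" if "J \<in> C" for J using C that by (auto simp: subset.chain_def)
    have "a + b \<in> \<Union> C" if ab: "a \<in> \<Union> C" "b \<in> \<Union> C" for a b
    proof -
      obtain J K where JK: "J \<in> C" "a \<in> J" "K \<in> C" "b \<in> K" using ab by blast
      then have "J \<subseteq> K \<or> K \<subseteq> J" using C(2) by (auto simp: subset_chain_def)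
      then have "a + b \<in> J \<or> a + b \<in> K" using JK sub[of J] sub[of K] unfolding proper_def by blast
      then show ?thesis using JK by blast
    qed
    moreover have "a * b \<in> \<Union> C" if ab: "a \<in> A" "b \<in> \<Union> C" for a b
      using ab sub unfolding proper_def by blast
    moreover have "I \<subseteq> \<Union> C" "\<Union> C \<subseteq> A" "1 \<notin> \<Union> C" using C(1) sub unfolding proper_def by blast+
    ultimately show "\<Union> C \<in> proper" unfolding proper_def by blast
  qed
  then obtain M where M: "M \<in> proper" and max: "\<And>J. J \<in> proper \<Longrightarrow> M \<subseteq> J \<Longrightarrow> J = M" by blast
  have add: "a + b \<in> M" if "a \<in> M" "b \<in> M" for a b using M that by (auto simp: proper_def)
  have mult: "a * b \<in> M" if "a \<in> A" "b \<in> M" for a b using M that by (auto simp: proper_def)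
  have MA: "M \<subseteq> A" "0 \<in> M" "1 \<notin> M" "I \<subseteq> M" using M I by (auto simp: proper_def)
  have Am: "a * b \<in> A" "a + b \<in> A" "1 \<in> A" "0 \<in> A" if "a \<in> A" "b \<in> A" for a b
    using that by (auto simp: A_def generated_algebra.intros alg_1 alg_0)
  have prime: "b \<in> M" if ab: "a \<in> A" "b \<in> A" "a * b \<in> M" "a \<notin> M" for a b
  proof -
    \<comment> \<open>The ideal generated by \<open>M\<close> and \<open>a\<close>, which is the unit ideal by maximality of \<open>M\<close>.\<close>
    define J where "J = {m + a * r | m r. m \<in> M \<and> r \<in> A}"
    have JI: "m + a * r \<in> J" if "m \<in> M" "r \<in> A" for m r using that by (auto simp: J_def)
    have "a \<in> J" using JI[of 0 1] MA(2) Am(3)[OF ab(1,1)] by simp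
    have "M \<subseteq> J" using JI[of _ 0] Am(4)[OF ab(1,1)] by auto
    have "J \<notin> proper" using max[OF _ \<open>M \<subseteq> J\<close>] \<open>a \<in> J\<close> ab(4) by blast
    moreover have "I \<subseteq> J" using \<open>M \<subseteq> J\<close> MA by blast
    moreover have "J \<subseteq> A" using MA ab Am unfolding J_def by blast
    moreover have "x + y \<in> J" if xy: "x \<in> J" "y \<in> J" for x y
    proof -
      obtain m r n s where *: "m \<in> M" "r \<in> A" "n \<in> M" "s \<in> A" "x = m + a * r" "y = n + a * s"
        using xy by (auto simp: J_def)
      have "x + y = (m + n) + a * (r + s)" by (simp add: * algebra_simps)
      then show ?thesis using JI[of "m + n" "r + s"] add Am * by metis
    qed
    moreover have "x * y \<in> J" if xy: "x \<in> A" "y \<in> J" for x y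
    proof -
      obtain m r where *: "m \<in> M" "r \<in> A" "y = m + a * r" using xy by (auto simp: J_def)
      have "x * y = x * m + a * (x * r)" by (simp add: * algebra_simps)
      then show ?thesis using JI[of "x * m" "x * r"] mult Am * xy by metis
    qed
    ultimately have "1 \<in> J" unfolding proper_def by blast
    then obtain m r where mr: "m \<in> M" "r \<in> A" "1 = m + a * r" by (auto simp: J_def)
    have "b = b * (m + a * r)" using mr by simp
    also have "\<dots> = b * m + r * (a * b)" by (simp add: algebra_simps)
    also have "\<dots> \<in> M" using add[OF mult[OF ab(2) mr(1)] mult[OF mr(2) ab(3)]] .
    finally show "b \<in> M" .
  qed
  have "prime_ideal_in A M"
    unfolding prime_ideal_in_def
  proof (intro conjI ballI impI)
    fix a b assume "a \<in> A" "b \<in> A" "a * b \<in> M"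
    then show "a \<in> M \<or> b \<in> M" using prime by blast
  qed (fact MA add mult)+
  then show ?thesis using MA by blast
qed

lemma prod_list_split_power:
  fixes x :: "'a::comm_monoid_mult"
  assumes "m \<le> count_list l x"
  shows "\<exists>l'. length l' + m = length l \<and> set l' \<subseteq> set l \<and> prod_list l = x ^ m * prod_list l'"
  using assms
proof (induction l arbitrary: m)
  case (Cons y l)
  show ?case
  proof (cases "y = x \<and> m > 0")
    case True
    then obtain n where n: "m = Suc n" by (cases m) auto
    then obtain l' where "length l' + n = length l" "set l' \<subseteq> set l" "prod_list l = x ^ n * prod_list l'"
      using Cons True by fastforce
    then show ?thesis using True n by (intro exI[of _ l']) (auto simp: mult.assoc)
  next
    case False
    then obtain l' where "length l' + m = length l" "set l' \<subseteq> set l" "prod_list l = x ^ m * prod_list l'"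
      using Cons.prems Cons.IH[of m] by (cases "y = x") auto
    then show ?thesis by (intro exI[of _ "y # l'"]) (auto simp: mult.left_commute)
  qed
qed simp

context smooth_curve
begin

text \<open>
  The denominators of \<open>h\<close> in \<open>A\<close>, together with \<open>0\<close>, form an ideal \<open>I\<close>.  A prime ideal containing \<open>I\<close> would be
  nonzero, hence give a closed point, at which \<open>h\<close> can be written with a denominator outside that
  prime ideal: a contradiction.  So \<open>1\<close> is a denominator.
\<close>
lemma regular_in_chart:
  assumes h: "\<And>P. P \<in> closed_points X \<Longrightarrow> h \<in> P"
    and A: "A = generated_algebra (emb X) S" "A \<in> charts X"
  shows "h \<in> A"
proof (rule ccontr)
  assume "h \<notin> A"
  define I where "I = {a \<in> A. a * h \<in> A}"
  have cl: "a + b \<in> A" "a * b \<in> A" "1 \<in> A" "0 \<in> A" if "a \<in> A" "b \<in> A" for a b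
    using that unfolding A by (auto simp: generated_algebra.intros alg_1 alg_0)
  have "1 \<in> A" "0 \<in> A" by (simp_all add: A alg_1 alg_0)
  have "\<exists>p. prime_ideal_in A p \<and> I \<subseteq> p"
  proof (rule proper_ideal_in_prime_ideal[where S = S and I = I, folded A(1)])
    show "I \<subseteq> A" by (auto simp: I_def)
    show "0 \<in> I" using \<open>0 \<in> A\<close> by (simp add: I_def)
    show "1 \<notin> I" using \<open>h \<notin> A\<close> by (simp add: I_def)
    show "a + b \<in> I" if "a \<in> I" "b \<in> I" for a b
      using that by (simp add: I_def cl distrib_right)
    show "a * b \<in> I" if "a \<in> A" "b \<in> I" for a b
      using that by (simp add: I_def cl mult.assoc)
  qed
  then obtain p where p: "prime_ideal_in A p" "I \<subseteq> p" by blast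
  let ?P = "localize A p"
  have "h \<in> localize A {0}" using chart_fraction_field[OF A(2)] by simp
  then obtain a s where as: "a \<in> A" "s \<in> A" "s \<noteq> 0" "h = a / s" by (auto simp: localize_def)
  then have "s \<in> p" using p(2) by (auto simp: I_def)
  \<comment> \<open>A nonzero denominator of \<open>h\<close> lies in \<open>p\<close> and is not invertible in the localization.\<close>
  have "?P \<noteq> UNIV"
  proof
    assume "?P = UNIV"
    then have "inverse s \<in> ?P" by simp
    then obtain b t where bt: "b \<in> A" "t \<in> A" "t \<notin> p" "inverse s = b / t" by (auto simp: localize_def)
    moreover have "t \<noteq> 0" using bt p(1) by (auto simp: prime_ideal_in_def)
    ultimately have "t = b * s" using as(3) by (simp add: field_simps)
    then show False using bt \<open>s \<in> p\<close> p(1) by (simp add: prime_ideal_in_def)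
  qed
  moreover have "?P \<in> points X" using A(2) p(1) by (auto simp: points_def)
  ultimately have "h \<in> ?P" by (intro h) (simp add: closed_points_def)
  then obtain b t where bt: "b \<in> A" "t \<in> A" "t \<notin> p" "h = b / t" by (auto simp: localize_def)
  moreover have "t \<noteq> 0" using bt p(1) by (auto simp: prime_ideal_in_def)
  ultimately have "t \<in> I" by (simp add: I_def)
  then show False using p(2) bt by blast
qed

text \<open>
  The values at the generic point of the homogeneous polynomials of degree \<open>n\<close> in the coordinates.
\<close>
definition forms :: "nat \<Rightarrow> 'f set" where
  "forms n = vs.span (prod_list ` {l. set l \<subseteq> set (coords X) \<and> length l = n})"

lemma finite_forms: "finite (forms n)"
  unfolding forms_def by (intro card_span_le finite_imageI finite_lists_length_eq) simp

lemma form_base: "set l \<subseteq> set (coords X) \<Longrightarrow> length l = n \<Longrightarrow> prod_list l \<in> forms n"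
  unfolding forms_def by (intro vs.span_base) auto

lemma forms_mult: "u \<in> forms m \<Longrightarrow> v \<in> forms n \<Longrightarrow> u * v \<in> forms (m + n)"
  unfolding forms_def
proof (rule span_mult)
  fix a b assume "a \<in> prod_list ` {l. set l \<subseteq> set (coords X) \<and> length l = m}"
    "b \<in> prod_list ` {l. set l \<subseteq> set (coords X) \<and> length l = n}"
  then obtain k l where "set (k @ l) \<subseteq> set (coords X)" "length (k @ l) = m + n" "a * b = prod_list (k @ l)"
    by auto
  then show "a * b \<in> vs.span (prod_list ` {l. set l \<subseteq> set (coords X) \<and> length l = m + n})"
    using form_base[of "k @ l"] by (simp add: forms_def)
qed

lemma coord_power_form: "x \<in> set (coords X) \<Longrightarrow> x ^ n \<in> forms n"
  using form_base[of "replicate n x" n] by (simp add: set_replicate_conv_if)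

text \<open>
  A polynomial of degree \<open>m\<close> in the quotients \<open>y / x\<close> becomes a form of degree \<open>m\<close> when multiplied by \<open>x ^ m\<close>,
  and further factors \<open>x\<close> only raise the degree.
\<close>
lemma clear_chart_denominators:
  assumes x: "x \<in> set (coords X)" "x \<noteq> 0"
    and a: "a \<in> generated_algebra (emb X) {y / x | y. y \<in> set (coords X)}"
  shows "\<exists>m. \<forall>n\<ge>m. a * x ^ n \<in> forms n"
proof -
  have more: "\<forall>n\<ge>m. b * x ^ n \<in> forms n" if m: "b * x ^ m \<in> forms m" for b m
  proof (intro allI impI)
    fix n assume "m \<le> n"
    then have "b * x ^ n = (b * x ^ m) * x ^ (n - m)" by (simp add: mult.assoc flip: power_add)
    then show "b * x ^ n \<in> forms n"
      using forms_mult[OF m coord_power_form[OF x(1), of "n - m"]] \<open>m \<le> n\<close> by (metis le_add_diff_inverse)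
  qed
  show ?thesis
    using a
  proof induction
    case (const c)
    have "emb X c * x ^ 0 \<in> forms 0"
      unfolding forms_def by (intro vs.span_scale vs.span_base) auto
    then show ?case using more by blast
  next
    case (gen s)
    then obtain y where "y \<in> set (coords X)" "s = y / x" by blast
    then have "s * x ^ 1 \<in> forms 1" using x form_base[of "[y]" 1] by simp
    then show ?case using more by blast
  next
    case (add a b)
    then obtain m n where "\<forall>k\<ge>m. a * x ^ k \<in> forms k" "\<forall>k\<ge>n. b * x ^ k \<in> forms k" by blast
    then show ?case
      by (intro exI[of _ "max m n"]) (auto simp: distrib_right forms_def intro: vs.span_add)
  next
    case (mult a b)
    then obtain m n where "a * x ^ m \<in> forms m" "b * x ^ n \<in> forms n" by blast
    from forms_mult[OF this] have "a * b * x ^ (m + n) \<in> forms (m + n)"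
      by (simp add: power_add mult_ac)
    then show ?case using more by blast
  qed
qed

text \<open>
  In every chart \<open>x \<noteq> 0\<close> the function \<open>h\<close> is a form of some degree divided by a power of \<open>x\<close>, so \<open>h * x ^ m\<close>
  is a form of degree \<open>m\<close> for a common exponent \<open>m\<close>.  A monomial of large degree \<open>N\<close> contains the
  \<open>m\<close>-th power of some coordinate, so multiplication by \<open>h\<close> maps the finite set of forms of degree \<open>N\<close> into
  itself.  Hence the powers of \<open>h\<close> repeat.
\<close>
lemma regular_root_of_unity:
  assumes h: "\<And>P. P \<in> closed_points X \<Longrightarrow> h \<in> P"
  shows "h = 0 \<or> (\<exists>n>0. h ^ n = 1)"
proof -
  let ?Z = "set (coords X)"
  have "\<exists>m. \<forall>n\<ge>m. h * x ^ n \<in> forms n" if x: "x \<in> ?Z" "x \<noteq> 0" for x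
  proof -
    have "generated_algebra (emb X) {y / x | y. y \<in> ?Z} \<in> charts X" using x by (auto simp: charts_def)
    from regular_in_chart[OF h refl this] show ?thesis by (rule clear_chart_denominators[OF x])
  qed
  then obtain \<mu> where \<mu>: "\<And>x n. x \<in> ?Z \<Longrightarrow> x \<noteq> 0 \<Longrightarrow> \<mu> x \<le> n \<Longrightarrow> h * x ^ n \<in> forms n" by metis
  define m where "m = (\<Sum>x\<in>?Z. \<mu> x)"
  have m: "h * x ^ m \<in> forms m" if x: "x \<in> ?Z" "x \<noteq> 0" for x
    using \<mu>[OF x] member_le_sum[OF x(1), of \<mu>] by (simp add: m_def)
  \<comment> \<open>More factors than this many coordinates can share with at most \<open>m\<close> occurrences each.\<close>
  define N where "N = card ?Z * m + 1"
  have "h * u \<in> forms N" if u: "u \<in> forms N" for u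
    unfolding forms_def
  proof (rule span_mult_left[OF _ u[unfolded forms_def]])
    fix b assume "b \<in> prod_list ` {l. set l \<subseteq> ?Z \<and> length l = N}"
    then obtain l where l: "set l \<subseteq> ?Z" "length l = N" "b = prod_list l" by blast
    have "\<exists>x\<in>set l. m < count_list l x"
    proof (rule ccontr)
      assume "\<not> ?thesis"
      then have "(\<Sum>x\<in>set l. count_list l x) \<le> card (set l) * m"
        using sum_bounded_above[of "set l" "count_list l" m] by (auto simp: not_less)
      also have "\<dots> \<le> card ?Z * m" using l by (intro mult_le_mono1 card_mono) auto
      finally show False using l(2) by (simp add: sum_count_set N_def)
    qed
    then obtain x where x: "x \<in> set l" "m < count_list l x" by blast
    have "h * b \<in> forms N"
    proof (cases "x = 0")
      case True
      then have "b = 0" using x l by (simp add: prod_list_zero_iff)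
      then show ?thesis by (simp add: forms_def vs.span_zero)
    next
      case False
      obtain l' where l': "length l' + m = N" "set l' \<subseteq> ?Z" "b = x ^ m * prod_list l'"
        using prod_list_split_power[of m l x] x l by (metis less_imp_le subset_trans)
      have "h * x ^ m * prod_list l' \<in> forms (m + length l')"
        using m[of x] False x l l' by (intro forms_mult form_base) auto
      then show ?thesis using l' by (simp add: mult.assoc add.commute)
    qed
    then show "h * b \<in> vs.span (prod_list ` {l. set l \<subseteq> ?Z \<and> length l = N})" by (simp add: forms_def)
  qed
  then have step: "h ^ j * u \<in> forms N" if "u \<in> forms N" for j u
    using that by (induction j) (auto simp: mult.assoc)
  have "charts X \<noteq> {}"
    using smooth_projective_curve by (simp add: smooth_projective_curve_def projective_integral_def)
  then obtain x where x: "x \<in> ?Z" "x \<noteq> 0" by (auto simp: charts_def)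
  have "range (\<lambda>j. h ^ j * x ^ N) \<subseteq> forms N" using step coord_power_form[OF x(1)] by auto
  then have "finite (range (\<lambda>j. h ^ j * x ^ N))" by (rule finite_subset[OF _ finite_forms])
  then have "\<not> inj (\<lambda>j. h ^ j * x ^ N)" using range_inj_infinite by blast
  then obtain i j where ij: "i < j" "h ^ i * x ^ N = h ^ j * x ^ N"
    by (auto simp: inj_def) (metis linorder_neqE_nat)
  have "h ^ i * h ^ (j - i) = h ^ j" using ij(1) by (simp flip: power_add)
  also have "\<dots> = h ^ i * 1" using ij(2) x by simp
  finally have "h ^ i * h ^ (j - i) = h ^ i * 1" .
  then have "h = 0 \<or> h ^ (j - i) = 1" by (metis mult_left_cancel power_not_zero)
  moreover have "j - i > 0" using ij(1) by simp
  ultimately show ?thesis by blast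
qed

text \<open>
  The value \<open>c\<close> of \<open>h\<close> at the rational point is a constant, and \<open>h - c\<close> is again without poles, but is
  not a unit at that point, unlike a root of unity.
\<close>
lemma regular_constant:
  assumes P: "P \<in> rational_points X" and h: "\<And>P. P \<in> closed_points X \<Longrightarrow> h \<in> P"
  shows "h \<in> range (emb X)"
proof -
  have cP: "P \<in> closed_points X" using P by (simp add: rational_points_def)
  obtain c where c: "h - emb X c \<in> max_ideal P"
    using P h[OF cP] by (auto simp: rational_points_def)
  let ?g = "h - emb X c"
  have g: "?g \<in> Q" if "Q \<in> closed_points X" for Q
    using vs.subspace_diff[OF point_subspace[OF that] h[OF that] point_const[OF that]] .
  have "?g = 0"
  proof (rule ccontr)
    assume "?g \<noteq> 0"
    then obtain n where n: "n > 0" "?g ^ n = 1" using regular_root_of_unity[OF g] by blast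
    then have "?g * ?g ^ (n - 1) = 1" by (simp flip: power_Suc)
    then have "?g \<in> units_of_ring P"
      using g[OF cP] point_power[OF cP] unfolding units_of_ring_def by blast
    then show False using c by (simp add: max_ideal_def)
  qed
  then show ?thesis by auto
qed

section \<open>Finiteness of Riemann-Roch spaces\<close>

text \<open>
  Induction on the total order of the allowed poles, where \<open>g\<close> prescribes the least order of vanishing.
  If a pole is allowed at \<open>Q\<close>, the functions with a given residue at the lowest order there form a
  translate of part of the space in which the order at \<open>Q\<close> is raised by one, and there are finitely
  many residues.
\<close>
lemma finite_prescribed_vanishing:
  assumes P: "P \<in> rational_points X" and F: "finite F" "\<And>Q. Q \<notin> F \<Longrightarrow> g Q \<ge> 0"
  shows "finite {h. \<forall>Q\<in>closed_points X. h \<in> vanishing Q (g Q)}"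
  using F(2)
proof (induction "\<Sum>Q\<in>F. nat (- g Q)" arbitrary: g)
  case 0
  then have "g Q \<ge> 0" for Q using F(1) by (cases "Q \<in> F") auto
  then have "h \<in> range (emb X)" if "\<forall>Q\<in>closed_points X. h \<in> vanishing Q (g Q)" for h
    using that vanishing_antimono vanishing_0 by (intro regular_constant[OF P]) blast
  then have "{h. \<forall>Q\<in>closed_points X. h \<in> vanishing Q (g Q)} \<subseteq> range (emb X)" by blast
  then show ?case by (rule finite_subset) simp
next
  case (Suc k)
  let ?L = "\<lambda>g. {h. \<forall>Q\<in>closed_points X. h \<in> vanishing Q (g Q)}"
  obtain Q where Q: "Q \<in> F" "g Q < 0"
  proof (rule ccontr)
    assume "\<not> thesis"
    then have "(\<Sum>Q\<in>F. nat (- g Q)) = 0" using that by (intro sum.neutral) force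
    then show False using Suc(2) by simp
  qed
  define g' where "g' = g(Q := g Q + 1)"
  have "(\<Sum>R\<in>F. nat (- g R)) = Suc (\<Sum>R\<in>F. nat (- g' R))"
    using Q F(1) by (simp add: sum.remove[of F Q] g'_def)
  then have fin: "finite (?L g')"
    using Suc Q by (intro Suc(1)) (auto simp: g'_def)
  show ?case
  proof (cases "Q \<in> closed_points X")
    case False
    then have "?L g = ?L g'" by (auto simp: g'_def)
    then show ?thesis using fin by simp
  next
    case True
    obtain T where T: "finite T" "\<forall>h\<in>vanishing Q (g Q). \<exists>\<tau>\<in>T. h - \<tau> \<in> vanishing Q (g Q + 1)"
      using vanishing_residues[OF True] by blast
    let ?F = "\<lambda>\<tau>. {h \<in> ?L g. h - \<tau> \<in> vanishing Q (g Q + 1)}"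
    have "finite (?F \<tau>)" for \<tau>
    proof (cases "?F \<tau> = {}")
      case True
      then show ?thesis by (simp only: finite.emptyI)
    next
      case False
      then obtain h\<^sub>0 where h0: "h\<^sub>0 \<in> ?F \<tau>" by blast
      have "h - h\<^sub>0 \<in> ?L g'" if h: "h \<in> ?F \<tau>" for h
      proof (intro CollectI ballI)
        fix R assume R: "R \<in> closed_points X"
        show "h - h\<^sub>0 \<in> vanishing R (g' R)"
        proof (cases "R = Q")
          case True
          then have "(h - \<tau>) - (h\<^sub>0 - \<tau>) \<in> vanishing R (g' R)"
            by (intro vs.subspace_diff[OF vanishing_subspace[OF R], of "h - \<tau>"])
               (use h h0 in \<open>auto simp: g'_def\<close>)
          then show ?thesis by simp
        next
          case False
          then show ?thesis
            using h h0 R by (intro vs.subspace_diff[OF vanishing_subspace]) (auto simp: g'_def)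
        qed
      qed
      then have "?F \<tau> \<subseteq> (+) h\<^sub>0 ` ?L g'"
        by (intro subsetI image_eqI[of _ _ "_ - h\<^sub>0"]) auto
      then show ?thesis using fin finite_subset by blast
    qed
    moreover have "?L g \<subseteq> (\<Union>\<tau>\<in>T. ?F \<tau>)" using T(2) True by blast
    ultimately show ?thesis using T(1) finite_subset by blast
  qed
qed

lemma finite_RR_space:
  assumes "P \<in> rational_points X"
  shows "finite (RR_space X G)"
  unfolding RR_space_eq
  by (rule finite_prescribed_vanishing[OF assms, of "Poly_Mapping.keys G"])
     (simp_all add: in_keys_iff)

end

section \<open>Evaluation at rational points\<close>

context smooth_curve
begin

lemma scale_by_eq: "scale_by X = (\<lambda>c h. emb X c * h)"
  by (intro ext) (simp add: scale_by_def)

lemma RR_space_subspace: "vs.subspace (RR_space X G)"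
proof -
  have "RR_space X G = (\<Inter>P\<in>closed_points X. vanishing P (- Poly_Mapping.lookup G P))"
    by (auto simp: RR_space_eq)
  then show ?thesis using vs.subspace_Inter vanishing_subspace by auto
qed

lemma RR_space_meet: "RR_space X (div_meet G A) = RR_space X G \<inter> RR_space X A"
proof -
  have "h \<in> vanishing Q (- min m n) \<longleftrightarrow> h \<in> vanishing Q (- m) \<and> h \<in> vanishing Q (- n)" for h Q m n
    by (auto simp: vanishing_def min_def)
  then show ?thesis by (auto simp: RR_space_eq div_meet.rep_eq)
qed

lemma RR_space_join: "RR_space X G + RR_space X A \<subseteq> RR_space X (div_join G A)"
proof -
  have "RR_space X G \<subseteq> RR_space X (div_join G A)" "RR_space X A \<subseteq> RR_space X (div_join G A)"
    by (force simp: RR_space_def div_join.rep_eq)+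
  then show ?thesis
    using vs.subspace_add[OF RR_space_subspace] by (blast elim!: set_plus_elim)
qed

lemma value_at_eq_iff:
  assumes P: "P \<in> rational_points X" and h: "h \<in> P"
  shows "value_at X P h = c \<longleftrightarrow> h - emb X c \<in> max_ideal P"
proof -
  have cP: "P \<in> closed_points X" using P by (simp add: rational_points_def)
  have uniq: "c = d" if "h - emb X c \<in> max_ideal P" "h - emb X d \<in> max_ideal P" for c d
  proof (rule ccontr)
    assume "c \<noteq> d"
    have "(h - emb X c) - (h - emb X d) \<in> max_ideal P"
      using vs.subspace_diff[OF vanishing_subspace[OF cP, of 1]] that by (simp only: vanishing_1[OF cP])
    then have "emb X (d - c) \<in> max_ideal P" by (simp add: e_diff)
    then show False using const_unit[OF cP, of "d - c"] \<open>c \<noteq> d\<close> by (simp add: max_ideal_def)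
  qed
  obtain d where d: "h - emb X d \<in> max_ideal P" using P h by (auto simp: rational_points_def)
  then have "value_at X P h = d" unfolding value_at_def using uniq by (intro the_equality) auto
  then show ?thesis using d uniq by blast
qed

lemma
  assumes P: "P \<in> rational_points X" and x: "x \<in> P"
  shows value_at_add: "y \<in> P \<Longrightarrow> value_at X P (x + y) = value_at X P x + value_at X P y"
    and value_at_scale: "value_at X P (emb X c * x) = c * value_at X P x"
    and value_at_eq_0_iff: "value_at X P x = 0 \<longleftrightarrow> x \<in> vanishing P 1"
proof -
  have cP: "P \<in> closed_points X" using P by (simp add: rational_points_def)
  note sub = vanishing_subspace[OF cP, of 1, unfolded vanishing_1[OF cP]]
  have val: "z - emb X (value_at X P z) \<in> max_ideal P" if "z \<in> P" for z
    using value_at_eq_iff[OF P that] by blast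
  show "value_at X P x = 0 \<longleftrightarrow> x \<in> vanishing P 1"
    using value_at_eq_iff[OF P x] by (simp add: vanishing_1[OF cP])
  have "emb X c * (x - emb X (value_at X P x)) \<in> max_ideal P"
    using vs.subspace_scale[OF sub val[OF x]] .
  then show "value_at X P (emb X c * x) = c * value_at X P x"
    using x point_mult[OF cP point_const[OF cP]]
    by (simp add: value_at_eq_iff[OF P] e_mult right_diff_distrib)
  assume y: "y \<in> P"
  have "(x - emb X (value_at X P x)) + (y - emb X (value_at X P y)) \<in> max_ideal P"
    using vs.subspace_add[OF sub val[OF x] val[OF y]] .
  then show "value_at X P (x + y) = value_at X P x + value_at X P y"
    using point_add[OF cP x y] by (simp add: value_at_eq_iff[OF P] e_add algebra_simps)
qed

context
  fixes P :: "'n::finite \<Rightarrow> 'f set"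
  assumes rational: "\<And>i. P i \<in> rational_points X"
begin

lemma ev_add:
  "(\<And>i. x \<in> P i) \<Longrightarrow> (\<And>i. y \<in> P i) \<Longrightarrow> ev X P (x + y) = ev X P x + ev X P y"
  by (simp add: ev_def vec_eq_iff value_at_add[OF rational])

lemma ev_scale: "(\<And>i. x \<in> P i) \<Longrightarrow> ev X P (emb X c * x) = c *s ev X P x"
  by (simp add: ev_def vec_eq_iff value_at_scale[OF rational])

lemma ev_eq_0_iff: "(\<And>i. x \<in> P i) \<Longrightarrow> ev X P x = 0 \<longleftrightarrow> (\<forall>i. x \<in> vanishing (P i) 1)"
  by (simp add: ev_def vec_eq_iff value_at_eq_0_iff[OF rational])

lemma RR_space_subset_point:
  assumes "Poly_Mapping.lookup G (P i) = 0" and "x \<in> RR_space X G"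
  shows "x \<in> P i"
proof -
  have "P i \<in> closed_points X" using rational[of i] by (simp add: rational_points_def)
  then show ?thesis using assms vanishing_0 by (force simp: RR_space_eq)
qed

lemma lookup_point_sum:
  assumes "inj P"
  shows "Poly_Mapping.lookup (point_sum P) Q = (if Q \<in> range P then 1 else 0)"
proof -
  have "Poly_Mapping.lookup (point_sum P) Q = (\<Sum>i\<in>UNIV. if Q = P i then 1 else 0)"
    by (simp add: point_sum_def lookup_sum lookup_single when_def)
  also have "\<dots> = int (card {i. Q = P i})" by (simp add: sum.If_cases)
  also have "{i. Q = P i} = (if Q \<in> range P then {inv_into UNIV P Q} else {})"
    using assms by (auto simp: inv_f_f)
  finally show ?thesis by simp
qed

text \<open>
  Where \<open>G\<close> has coefficient \<open>0\<close>, subtracting the point imposes vanishing there, that is, value zero.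
\<close>
lemma RR_space_minus_point_sum:
  assumes inj: "inj P" and G: "\<And>i. Poly_Mapping.lookup G (P i) = 0"
  shows "RR_space X (G - point_sum P) = {x \<in> RR_space X G. ev X P x = 0}"
proof -
  have closed: "P i \<in> closed_points X" for i using rational[of i] by (simp add: rational_points_def)
  have "h \<in> RR_space X (G - point_sum P) \<longleftrightarrow> h \<in> RR_space X G \<and> (\<forall>i. h \<in> vanishing (P i) 1)" for h
  proof
    assume h: "h \<in> RR_space X (G - point_sum P)"
    then have *: "h \<in> vanishing Q (- Poly_Mapping.lookup G Q + (if Q \<in> range P then 1 else 0))"
      if "Q \<in> closed_points X" for Q
      using that by (auto simp: RR_space_eq lookup_minus lookup_point_sum[OF inj])
    have "h \<in> vanishing (P i) 1" for i using *[OF closed] G by simp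
    moreover have "h \<in> vanishing Q (- Poly_Mapping.lookup G Q)" if "Q \<in> closed_points X" for Q
      using *[OF that] by (auto simp: vanishing_def split: if_splits)
    ultimately show "h \<in> RR_space X G \<and> (\<forall>i. h \<in> vanishing (P i) 1)" by (auto simp: RR_space_eq)
  next
    assume "h \<in> RR_space X G \<and> (\<forall>i. h \<in> vanishing (P i) 1)"
    then show "h \<in> RR_space X (G - point_sum P)"
      using G by (auto simp: RR_space_eq lookup_minus lookup_point_sum[OF inj])
  qed
  then show ?thesis using ev_eq_0_iff RR_space_subset_point[OF G] by blast
qed

end

end

theorem theorem3p1:
  fixes X :: "('k::{field,finite}, 'f::field) curve"
    and P :: "'n::finite \<Rightarrow> 'f set"
    and D G A :: "'f divisor"
  assumes "smooth_projective_curve X"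
    and "geometrically_irreducible X"
    and "inj P"
    and "\<And>i. P i \<in> rational_points X"
    and "D = point_sum P"
    and "is_divisor X G"
    and "is_divisor X A"
    and "Poly_Mapping.keys G \<inter> Poly_Mapping.keys D = {}"
    and "Poly_Mapping.keys A \<inter> Poly_Mapping.keys D = {}"
  shows "(R0_space X D G A \<subseteq> R_space X D G A \<and> 0 \<le> excess X D G A) \<and>
    AG_code X P (div_meet G A) \<subseteq> AG_code X P G \<inter> AG_code X P A \<and>
    (let Q\<^sub>C = quotient_space (*s) (AG_code X P G \<inter> AG_code X P A) (AG_code X P (div_meet G A));
         Q\<^sub>R = quotient_space (scale_by X) (R_space X D G A) (R0_space X D G A)
     in \<exists>\<phi>. linear_map scalar_field Q\<^sub>C Q\<^sub>R \<phi> \<and> bij_betw \<phi> (carrier Q\<^sub>C) (carrier Q\<^sub>R) \<and>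
          (\<forall>g\<in>RR_space X G. \<forall>a\<in>RR_space X A. ev X P g = ev X P a \<longrightarrow>
            \<phi> (ev X P g +o AG_code X P (div_meet G A)) = (g - a) +o R0_space X D G A)) \<and>
    int (vec.dim (AG_code X P G \<inter> AG_code X P A)) =
      int (ell X (div_meet G A)) - int (ell X (div_meet G A - D)) + int (excess X D G A)"
proof -
  interpret smooth_curve X by unfold_locales fact
  note inj = \<open>inj P\<close> and rational = \<open>\<And>i. P i \<in> rational_points X\<close> and D = \<open>D = point_sum P\<close>
  define U where "U = RR_space X G"
  define V where "V = RR_space X A"
  have meet: "RR_space X (div_meet G A) = U \<inter> V" by (simp add: U_def V_def RR_space_meet)
  have "Poly_Mapping.lookup D (P i) \<noteq> 0" for i
    unfolding D by (simp add: lookup_point_sum[OF rational inj])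
  then have G: "Poly_Mapping.lookup G (P i) = 0" and A: "Poly_Mapping.lookup A (P i) = 0" for i
    using assms(8,9) by (metis IntI empty_iff in_keys_iff)+
  have join_point: "Poly_Mapping.lookup (div_join G A) (P i) = 0"
    and meet_point: "Poly_Mapping.lookup (div_meet G A) (P i) = 0" for i
    by (simp_all add: div_join.rep_eq div_meet.rep_eq G A)
  \<comment> \<open>The sum \<open>L(G) + L(A)\<close> consists of functions that are regular at every point of \<open>D\<close>.\<close>
  have UV_join: "U + V \<subseteq> RR_space X (div_join G A)" unfolding U_def V_def by (rule RR_space_join)
  have UV_point: "x \<in> P i" if "x \<in> U + V" for x i
    by (rule RR_space_subset_point[OF rational join_point subsetD[OF UV_join that]])
  have evadd: "ev X P (x + y) = ev X P x + ev X P y" if "x \<in> U + V" "y \<in> U + V" for x y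
    using that UV_point by (intro ev_add[OF rational])
  have evscale: "ev X P (emb X c * x) = c *s ev X P x" if "x \<in> U + V" for c x
    using that UV_point by (intro ev_scale[OF rational])
  note kernel = RR_space_minus_point_sum[OF rational inj, folded D]
  have R: "R_space X D G A = {x \<in> U + V. ev X P x = 0}"
    unfolding R_space_def kernel[OF join_point] using UV_join by (auto simp: U_def V_def)
  have R0: "R0_space X D G A = {x \<in> U. ev X P x = 0} + {x \<in> V. ev X P x = 0}"
    unfolding R0_space_def kernel[OF G] kernel[OF A] U_def V_def ..
  have C: "AG_code X P G = ev X P ` U" "AG_code X P A = ev X P ` V"
    "AG_code X P (div_meet G A) = ev X P ` (U \<inter> V)"
    by (simp_all add: AG_code_def U_def V_def RR_space_meet)
  have subU: "vs.subspace U" and subV: "vs.subspace V" by (simp_all add: U_def V_def RR_space_subspace)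
  have vsC: "vector_space ((*s) :: 'k \<Rightarrow> 'k ^ 'n \<Rightarrow> 'k ^ 'n)" by (rule vec.vector_space_axioms)
  note iso = image_inter_quotient_iso[OF vs.vector_space_axioms vsC subU subV, of "ev X P",
      OF evadd evscale,
      folded R R0 C scale_by_eq]
  let ?QC = "quotient_space (*s) (AG_code X P G \<inter> AG_code X P A) (AG_code X P (div_meet G A))"
  let ?QR = "quotient_space (scale_by X) (R_space X D G A) (R0_space X D G A)"
  have inU: "x \<in> U + V" if "x \<in> U" for x
    using set_plus_intro[OF that vs.subspace_0[OF subV]] by simp
  have inV: "x \<in> U + V" if "x \<in> V" for x
    using set_plus_intro[OF vs.subspace_0[OF subU] that] by simp
  have "R0_space X D G A \<subseteq> R_space X D G A"
    unfolding R R0 using inU inV evadd by (auto elim!: set_plus_elim)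
  moreover have codes: "AG_code X P (div_meet G A) \<subseteq> AG_code X P G \<inter> AG_code X P A"
    unfolding C by blast
  moreover obtain \<phi> where \<phi>: "linear_map scalar_field ?QC ?QR \<phi>" "bij_betw \<phi> (carrier ?QC) (carrier ?QR)"
    "\<forall>g\<in>U. \<forall>a\<in>V. ev X P g = ev X P a \<longrightarrow>
            \<phi> (ev X P g +o AG_code X P (div_meet G A)) = (g - a) +o R0_space X D G A"
    using iso(5) by blast
  moreover have "int (vec.dim (AG_code X P G \<inter> AG_code X P A)) =
      int (ell X (div_meet G A)) - int (ell X (div_meet G A - D)) + int (excess X D G A)"
  proof -
    \<comment> \<open>The isomorphism transports the dimension of the quotient because it preserves cardinality.\<close>
    have finC: "finite (carrier ?QC)" by (simp add: vec.quotient_carrier)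
    then have finR: "finite (carrier ?QR)" using \<phi>(2) bij_betw_finite by blast
    have vsQ: "vectorspace (scalar_field :: 'k ring) ?QC" "vectorspace (scalar_field :: 'k ring) ?QR"
      using \<phi>(1) by (simp_all add: linear_map_def)
    have "CARD('k) ^ vectorspace.dim (scalar_field :: 'k ring) ?QC
        = CARD('k) ^ vectorspace.dim (scalar_field :: 'k ring) ?QR"
      using card_carrier_vectorspace[OF vsQ(1) finC] card_carrier_vectorspace[OF vsQ(2) finR]
        bij_betw_same_card[OF \<phi>(2)] by simp
    then have "vectorspace.dim (scalar_field :: 'k ring) ?QC = excess X D G A"
      by (simp only: CARD_field_power_inject excess_def)
    then have "vec.dim (AG_code X P G \<inter> AG_code X P A)
        = vec.dim (AG_code X P (div_meet G A)) + excess X D G A"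
      using dim_quotient[OF vsC iso(1) iso(2) codes] by simp
    moreover have "ell X (div_meet G A) = ell X (div_meet G A - D) + vec.dim (AG_code X P (div_meet G A))"
    proof -
      let ?T = "RR_space X (div_meet G A)"
      have "vs.dim ?T = vs.dim {x \<in> ?T. ev X P x = 0} + vec.dim (ev X P ` ?T)"
      proof (rule dim_image_kernel[OF vs.vector_space_axioms vsC])
        show "vs.subspace {x \<in> ?T. ev X P x = 0}"
          unfolding kernel[OF meet_point, symmetric] by (rule RR_space_subspace)
        show "vec.subspace (ev X P ` ?T)" using iso(2) by (simp add: C meet)
        show "ev X P (x + y) = ev X P x + ev X P y" if "x \<in> ?T" "y \<in> ?T" for x y
          using that inU by (intro evadd) (auto simp: meet)
      qed (auto intro: RR_space_subspace finite_RR_space[OF rational])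
      then show ?thesis
        by (simp add: ell_def scale_by_eq AG_code_def kernel[OF meet_point])
    qed
    ultimately show ?thesis by simp
  qed
  ultimately show ?thesis unfolding Let_def U_def V_def by blast
qed

end
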